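(* Let $\mathbb{F}$ be an algebraically closed field with $\mathrm{Char}(\mathbb{F})\neq 2$ and let $d\ge 3$. Let $B,A^*$ be a bipartite Leonard pair over $\mathbb{F}$ with diameter $d$ that has Krawtchouk type. Let $(\{\theta'_i\}_{i=0}^d;\{\theta^*_i\}_{i=0}^d;\{\varphi'_i\}_{i=1}^d;\{\phi'_i\}_{i=1}^d)$ be a parameter array of $B,A^*$ with corresponding primary data $(\delta',\mu',h',\delta^*,\mu^*,h^*,\tau')$. For scalars $\delta,\mu,h,\tau$ in $\mathbb{F}$ the following are equivalent: (i) the sequence $(\delta,\mu,h,\delta^*,\mu^*,h^*,\tau)$ is a primary data of a near-bipartite expansion $A,A^*$ of $B,A^*$; (ii) the following conditions hold: $\mu\neq0$; $h=0$; $4\tau^2=(\mu^2-\mu'^2)\mu^{*2}$. Assume that (i) and (ii) hold. Then $A,A^*$ has Krawtchouk type.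
   Context: A tridiagonal matrix is irreducible if all its subdiagonal and superdiagonal entries are nonzero. Let $V$ be a vector space over $\mathbb{F}$ of dimension $d+1$. A Leonard pair on $V$ (with diameter $d$, over $\mathbb{F}$) is an ordered pair $A,A^*$ in $\mathrm{End}(V)$ such that (a) some basis of $V$ makes the matrix of $A$ irreducible tridiagonal and that of $A^*$ diagonal; (b) some basis of $V$ makes the matrix of $A^*$ irreducible tridiagonal and that of $A$ diagonal. ($A^*$ is just a name, not an adjoint.) Each of $A,A^*$ then has $d+1$ distinct eigenvalues. Flat part: let $E^*_0,\dots,E^*_d$ be the primitive idempotents of $A^*$ (projections onto its eigenspaces along the sum of the other eigenspaces). The flat part of $A$ is $F=\sum_{i=0}^d E^*_i A E^*_i$. $A,A^*$ is bipartite if $F=0$. $A,A^*$ is near-bipartite if $A-F,A^*$ is a Leonard pair on $V$; in that case $A-F,A^*$ is a bipartite Leonard pair called the bipartite contraction of $A,A^*$. A near-bipartite expansion of a bipartite Leonard pair $B,A^*$ on $V$ is a near-bipartite Leonard pair $A,A^*$ on $V$ whose bipartite contraction equals $B,A^*$. Parameter array: an ordering $\{\theta_i\}_{i=0}^d$ of the eigenvalues of $A$ is standard if in some basis $A$ is $\mathrm{diag}(\theta_0,\dots,\theta_d)$ and $A^*$ is irreducible tridiagonal; a standard ordering $\{\theta^*_i\}_{i=0}^d$ of the eigenvalues of $A^*$ is defined with the roles of $A$ and $A^*$ exchanged. Given standard orderings, there are unique scalars $\{\varphi_i\}_{i=1}^d$ such that in some basis $A$ is lower bidiagonal with diagonal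 $\theta_0,\dots,\theta_d$ and all subdiagonal entries $1$, while $A^*$ is upper bidiagonal with diagonal $\theta^*_0,\dots,\theta^*_d$ and superdiagonal $\varphi_1,\dots,\varphi_d$; and unique scalars $\{\phi_i\}_{i=1}^d$ such that in some basis $A$ is lower bidiagonal with diagonal $\theta_d,\theta_{d-1},\dots,\theta_0$ and all subdiagonal entries $1$, while $A^*$ is upper bidiagonal with diagonal $\theta^*_0,\dots,\theta^*_d$ and superdiagonal $\phi_1,\dots,\phi_d$. The sequence $(\{\theta_i\};\{\theta^*_i\};\{\varphi_i\};\{\phi_i\})$ is a parameter array of $A,A^*$. Type II: for $d\ge 3$ it is known that $\frac{\theta_{i-2}-\theta_{i+1}}{\theta_{i-1}-\theta_i}$ and $\frac{\theta^*_{i-2}-\theta^*_{i+1}}{\theta^*_{i-1}-\theta^*_i}$ are equal and independent of $i$ for $2\le i\le d-1$; their common value is written $\beta+1$. $A,A^*$ has type II if $\beta=2$. It is known that a parameter array of type II has the form $\theta_i=\delta+\mu(i-d/2)+hi(d-i)$, $\theta^*_i=\delta^*+\mu^*(i-d/2)+h^*i(d-i)$ $(0\le i\le d)$, $\varphi_i=i(d-i+1)\big(\tau-\mu\mu^*/2+(h\mu^*+\mu h^* )(i-(d+1)/2)+hh^*(i-1)(d-i)\big)$, $\phi_i=i(d-i+1)\big(\tau+\mu\mu^*/2+(h\mu^*-\mu h^* )(i-(d+1)/2)+hh^*(i-1)(d-i)\big)$ $(1\le i\le d)$ for a unique sequence $(\delta,\mu,h,\delta^*,\mu^*,h^*,\tau)$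 of scalars in $\mathbb{F}$, called the primary data corresponding to the parameter array. A primary data of a type II Leonard pair $A,A^*$ is the primary data corresponding to some parameter array of $A,A^*$. $A,A^*$ has Krawtchouk type if it has type II and both $\theta_i-\theta_{i-1}$ and $\theta^*_i-\theta^*_{i-1}$ are independent of $i$ for $1\le i\le d$. *)

theory Defs
  imports "HOL-Computational_Algebra.Polynomial"
begin

text \<open>
  The vector space \<open>V\<close> is a whole type \<open>'v\<close> with scalar multiplication \<open>scale\<close>, as in the
  library locale \<^locale>\<open>vector_space\<close>. Sequences \<open>x\<^sub>0, \<dots>, x\<^sub>d\<close> and square matrices of order
  \<open>d + 1\<close> are functions on \<^typ>\<open>nat\<close>, of which only the values at indices up to \<open>d\<close> matter.
\<close>

section \<open>Bases and matrices\<close>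

definition ordered_basis ::
  "('f::field \<Rightarrow> 'v::ab_group_add \<Rightarrow> 'v) \<Rightarrow> nat \<Rightarrow> (nat \<Rightarrow> 'v) \<Rightarrow> bool" where
  "ordered_basis scale d b \<longleftrightarrow>
     inj_on b {0..d} \<and> \<not> module.dependent scale (b ` {0..d}) \<and>
     module.span scale (b ` {0..d}) = UNIV"

text \<open>Columns of \<open>M\<close> hold the coordinates of the images of the basis vectors.\<close>

definition represents ::
  "('f::field \<Rightarrow> 'v::ab_group_add \<Rightarrow> 'v) \<Rightarrow> nat \<Rightarrow> (nat \<Rightarrow> 'v) \<Rightarrow> ('v \<Rightarrow> 'v) \<Rightarrow>
   (nat \<Rightarrow> nat \<Rightarrow> 'f) \<Rightarrow> bool" where
  "represents scale d b A M \<longleftrightarrow> (\<forall>j\<le>d. A (b j) = (\<Sum>i=0..d. scale (M i j) (b i)))"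

definition irred_tridiagonal :: "nat \<Rightarrow> (nat \<Rightarrow> nat \<Rightarrow> 'f::field) \<Rightarrow> bool" where
  "irred_tridiagonal d M \<longleftrightarrow>
     (\<forall>i\<le>d. \<forall>j\<le>d. (Suc i < j \<or> Suc j < i) \<longrightarrow> M i j = 0) \<and>
     (\<forall>i<d. M (Suc i) i \<noteq> 0 \<and> M i (Suc i) \<noteq> 0)"

definition diagonal :: "nat \<Rightarrow> (nat \<Rightarrow> nat \<Rightarrow> 'f::field) \<Rightarrow> bool" where
  "diagonal d M \<longleftrightarrow> (\<forall>i\<le>d. \<forall>j\<le>d. i \<noteq> j \<longrightarrow> M i j = 0)"

definition diag_mat :: "(nat \<Rightarrow> 'f::field) \<Rightarrow> nat \<Rightarrow> nat \<Rightarrow> 'f" where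
  "diag_mat x i j = (if i = j then x i else 0)"

definition lower_bidiag :: "(nat \<Rightarrow> 'f::field) \<Rightarrow> nat \<Rightarrow> nat \<Rightarrow> 'f" where
  "lower_bidiag x i j = (if i = j then x i else if i = Suc j then 1 else 0)"

text \<open>The superdiagonal entries are \<open>y 1, \<dots>, y d\<close>; \<open>y j\<close> stands in column \<open>j\<close>.\<close>

definition upper_bidiag :: "(nat \<Rightarrow> 'f::field) \<Rightarrow> (nat \<Rightarrow> 'f) \<Rightarrow> nat \<Rightarrow> nat \<Rightarrow> 'f" where
  "upper_bidiag x y i j = (if i = j then x i else if j = Suc i then y j else 0)"

section \<open>Leonard pairs\<close>

definition leonard_pair ::
  "('f::field \<Rightarrow> 'v::ab_group_add \<Rightarrow> 'v) \<Rightarrow> nat \<Rightarrow> ('v \<Rightarrow> 'v) \<Rightarrow> ('v \<Rightarrow> 'v) \<Rightarrow> bool" where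
  "leonard_pair scale d A As \<longleftrightarrow>
     vector_space.dim scale UNIV = d + 1 \<and>
     Vector_Spaces.linear scale scale A \<and> Vector_Spaces.linear scale scale As \<and>
     (\<exists>b M N. ordered_basis scale d b \<and> represents scale d b A M \<and> represents scale d b As N \<and>
        irred_tridiagonal d M \<and> diagonal d N) \<and>
     (\<exists>b M N. ordered_basis scale d b \<and> represents scale d b As M \<and> represents scale d b A N \<and>
        irred_tridiagonal d M \<and> diagonal d N)"

definition eigenspace ::
  "('f::field \<Rightarrow> 'v::ab_group_add \<Rightarrow> 'v) \<Rightarrow> ('v \<Rightarrow> 'v) \<Rightarrow> 'f \<Rightarrow> 'v set" where
  "eigenspace scale A x = {v. A v = scale x v}"

definition eigenvalues ::
  "('f::field \<Rightarrow> 'v::ab_group_add \<Rightarrow> 'v) \<Rightarrow> ('v \<Rightarrow> 'v) \<Rightarrow> 'f set" where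
  "eigenvalues scale A = {x. \<exists>v\<in>eigenspace scale A x. v \<noteq> 0}"

text \<open>
  The projection onto one eigenspace along the sum of the others. The description is
  meaningful when \<open>A\<close> is diagonalizable, which holds for both members of a Leonard pair.
\<close>

definition primitive_idempotent ::
  "('f::field \<Rightarrow> 'v::ab_group_add \<Rightarrow> 'v) \<Rightarrow> ('v \<Rightarrow> 'v) \<Rightarrow> 'f \<Rightarrow> 'v \<Rightarrow> 'v" where
  "primitive_idempotent scale A x =
     (THE E. Vector_Spaces.linear scale scale E \<and>
        (\<forall>v\<in>eigenspace scale A x. E v = v) \<and>
        (\<forall>v\<in>module.span scale (\<Union>y\<in>eigenvalues scale A - {x}. eigenspace scale A y). E v = 0))"

section \<open>Flat part, bipartite and near-bipartite Leonard pairs\<close>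

text \<open>The primitive idempotents are indexed by the eigenvalues, so no ordering is needed.\<close>

definition flat_part ::
  "('f::field \<Rightarrow> 'v::ab_group_add \<Rightarrow> 'v) \<Rightarrow> ('v \<Rightarrow> 'v) \<Rightarrow> ('v \<Rightarrow> 'v) \<Rightarrow> 'v \<Rightarrow> 'v" where
  "flat_part scale A As v =
     (\<Sum>x\<in>eigenvalues scale As.
        primitive_idempotent scale As x (A (primitive_idempotent scale As x v)))"

definition bipartite_leonard_pair ::
  "('f::field \<Rightarrow> 'v::ab_group_add \<Rightarrow> 'v) \<Rightarrow> nat \<Rightarrow> ('v \<Rightarrow> 'v) \<Rightarrow> ('v \<Rightarrow> 'v) \<Rightarrow> bool" where
  "bipartite_leonard_pair scale d A As \<longleftrightarrow>
     leonard_pair scale d A As \<and> (\<forall>v. flat_part scale A As v = 0)"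

definition remove_flat ::
  "('f::field \<Rightarrow> 'v::ab_group_add \<Rightarrow> 'v) \<Rightarrow> ('v \<Rightarrow> 'v) \<Rightarrow> ('v \<Rightarrow> 'v) \<Rightarrow> 'v \<Rightarrow> 'v" where
  "remove_flat scale A As v = A v - flat_part scale A As v"

definition near_bipartite_leonard_pair ::
  "('f::field \<Rightarrow> 'v::ab_group_add \<Rightarrow> 'v) \<Rightarrow> nat \<Rightarrow> ('v \<Rightarrow> 'v) \<Rightarrow> ('v \<Rightarrow> 'v) \<Rightarrow> bool" where
  "near_bipartite_leonard_pair scale d A As \<longleftrightarrow>
     leonard_pair scale d A As \<and> leonard_pair scale d (remove_flat scale A As) As"

text \<open>\<open>A, As\<close> is a near-bipartite expansion of \<open>B, As\<close>.\<close>

definition near_bipartite_expansion ::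
  "('f::field \<Rightarrow> 'v::ab_group_add \<Rightarrow> 'v) \<Rightarrow> nat \<Rightarrow> ('v \<Rightarrow> 'v) \<Rightarrow> ('v \<Rightarrow> 'v) \<Rightarrow> ('v \<Rightarrow> 'v) \<Rightarrow> bool"
  where
  "near_bipartite_expansion scale d A B As \<longleftrightarrow>
     bipartite_leonard_pair scale d B As \<and>
     near_bipartite_leonard_pair scale d A As \<and> remove_flat scale A As = B"

section \<open>Parameter arrays\<close>

text \<open>
  \<open>th\<close> is a standard ordering of the eigenvalues of \<open>A\<close>; those of \<open>As\<close> are obtained by
  swapping \<open>A\<close> and \<open>As\<close>.
\<close>

definition standard_ordering ::
  "('f::field \<Rightarrow> 'v::ab_group_add \<Rightarrow> 'v) \<Rightarrow> nat \<Rightarrow> ('v \<Rightarrow> 'v) \<Rightarrow> ('v \<Rightarrow> 'v) \<Rightarrow> (nat \<Rightarrow> 'f) \<Rightarrow> bool"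
  where
  "standard_ordering scale d A As th \<longleftrightarrow>
     bij_betw th {0..d} (eigenvalues scale A) \<and>
     (\<exists>b M. ordered_basis scale d b \<and> represents scale d b A (diag_mat th) \<and>
        represents scale d b As M \<and> irred_tridiagonal d M)"

text \<open>
  \<open>fsp\<close> and \<open>ssp\<close> are the first and second split sequences, written with the variant phi and
  the ordinary phi in the literature; they are indexed by \<open>1, \<dots>, d\<close>.
\<close>

definition parameter_array ::
  "('f::field \<Rightarrow> 'v::ab_group_add \<Rightarrow> 'v) \<Rightarrow> nat \<Rightarrow> ('v \<Rightarrow> 'v) \<Rightarrow> ('v \<Rightarrow> 'v) \<Rightarrow>
   (nat \<Rightarrow> 'f) \<Rightarrow> (nat \<Rightarrow> 'f) \<Rightarrow> (nat \<Rightarrow> 'f) \<Rightarrow> (nat \<Rightarrow> 'f) \<Rightarrow> bool" where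
  "parameter_array scale d A As th ths fsp ssp \<longleftrightarrow>
     leonard_pair scale d A As \<and>
     standard_ordering scale d A As th \<and> standard_ordering scale d As A ths \<and>
     (\<exists>b. ordered_basis scale d b \<and>
        represents scale d b A (lower_bidiag th) \<and>
        represents scale d b As (upper_bidiag ths fsp)) \<and>
     (\<exists>b. ordered_basis scale d b \<and>
        represents scale d b A (lower_bidiag (\<lambda>i. th (d - i))) \<and>
        represents scale d b As (upper_bidiag ths ssp))"

section \<open>Type II and Krawtchouk type\<close>

text \<open>
  The scalar \<open>\<beta>\<close> does not depend on the chosen standard orderings: they are unique up to
  reversal, and reversal of either one permutes its ratios.
\<close>

definition has_beta ::
  "('f::field \<Rightarrow> 'v::ab_group_add \<Rightarrow> 'v) \<Rightarrow> nat \<Rightarrow> ('v \<Rightarrow> 'v) \<Rightarrow> ('v \<Rightarrow> 'v) \<Rightarrow> 'f \<Rightarrow> bool" where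
  "has_beta scale d A As \<beta> \<longleftrightarrow>
     (\<exists>th ths. standard_ordering scale d A As th \<and> standard_ordering scale d As A ths \<and>
        (\<forall>i\<in>{2..d-1}.
           (th (i-2) - th (i+1)) / (th (i-1) - th i) = \<beta> + 1 \<and>
           (ths (i-2) - ths (i+1)) / (ths (i-1) - ths i) = \<beta> + 1))"

definition type_II ::
  "('f::field \<Rightarrow> 'v::ab_group_add \<Rightarrow> 'v) \<Rightarrow> nat \<Rightarrow> ('v \<Rightarrow> 'v) \<Rightarrow> ('v \<Rightarrow> 'v) \<Rightarrow> bool" where
  "type_II scale d A As \<longleftrightarrow> 3 \<le> d \<and> leonard_pair scale d A As \<and> has_beta scale d A As 2"

definition krawtchouk_type ::
  "('f::field \<Rightarrow> 'v::ab_group_add \<Rightarrow> 'v) \<Rightarrow> nat \<Rightarrow> ('v \<Rightarrow> 'v) \<Rightarrow> ('v \<Rightarrow> 'v) \<Rightarrow> bool" where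
  "krawtchouk_type scale d A As \<longleftrightarrow>
     type_II scale d A As \<and>
     (\<exists>th ths. standard_ordering scale d A As th \<and> standard_ordering scale d As A ths \<and>
        (\<exists>c. \<forall>i\<in>{1..d}. th i - th (i-1) = c) \<and>
        (\<exists>c. \<forall>i\<in>{1..d}. ths i - ths (i-1) = c))"

section \<open>Primary data\<close>

text \<open>
  For a parameter array of type II these equations have exactly one solution
  \<open>(\<delta>, \<mu>, h, \<delta>s, \<mu>s, hs, \<tau>)\<close>, so the relation below determines the primary data.
\<close>

definition primary_data_of_array ::
  "nat \<Rightarrow> (nat \<Rightarrow> 'f::field) \<Rightarrow> (nat \<Rightarrow> 'f) \<Rightarrow> (nat \<Rightarrow> 'f) \<Rightarrow> (nat \<Rightarrow> 'f) \<Rightarrow>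
   'f \<Rightarrow> 'f \<Rightarrow> 'f \<Rightarrow> 'f \<Rightarrow> 'f \<Rightarrow> 'f \<Rightarrow> 'f \<Rightarrow> bool" where
  "primary_data_of_array d th ths fsp ssp \<delta> \<mu> h \<delta>s \<mu>s hs \<tau> \<longleftrightarrow>
     (\<forall>i\<le>d. th i = \<delta> + \<mu> * (of_nat i - of_nat d / 2) + h * of_nat i * of_nat (d - i)) \<and>
     (\<forall>i\<le>d. ths i = \<delta>s + \<mu>s * (of_nat i - of_nat d / 2) + hs * of_nat i * of_nat (d - i)) \<and>
     (\<forall>i\<in>{1..d}. fsp i = of_nat i * of_nat (d - i + 1) *
        (\<tau> - \<mu> * \<mu>s / 2 + (h * \<mu>s + \<mu> * hs) * (of_nat i - of_nat (d + 1) / 2)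
         + h * hs * of_nat (i - 1) * of_nat (d - i))) \<and>
     (\<forall>i\<in>{1..d}. ssp i = of_nat i * of_nat (d - i + 1) *
        (\<tau> + \<mu> * \<mu>s / 2 + (h * \<mu>s - \<mu> * hs) * (of_nat i - of_nat (d + 1) / 2)
         + h * hs * of_nat (i - 1) * of_nat (d - i)))"

definition primary_data ::
  "('f::field \<Rightarrow> 'v::ab_group_add \<Rightarrow> 'v) \<Rightarrow> nat \<Rightarrow> ('v \<Rightarrow> 'v) \<Rightarrow> ('v \<Rightarrow> 'v) \<Rightarrow>
   'f \<Rightarrow> 'f \<Rightarrow> 'f \<Rightarrow> 'f \<Rightarrow> 'f \<Rightarrow> 'f \<Rightarrow> 'f \<Rightarrow> bool" where
  "primary_data scale d A As \<delta> \<mu> h \<delta>s \<mu>s hs \<tau> \<longleftrightarrow>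
     type_II scale d A As \<and>
     (\<exists>th ths fsp ssp. parameter_array scale d A As th ths fsp ssp \<and>
        primary_data_of_array d th ths fsp ssp \<delta> \<mu> h \<delta>s \<mu>s hs \<tau>)"

end

theory Submission
  imports Defs
begin

text \<open>
  In a basis that makes \<open>A\<^sup>*\<close> diagonal and \<open>A\<close> irreducible tridiagonal, the diagonal entries
  \<open>a\<^sub>i\<close> of \<open>A\<close> and the products \<open>x\<^sub>i\<close> of opposite off-diagonal entries can be read off from the first
  split basis alone, by expanding the eigenvectors of \<open>A\<^sup>*\<close> in that basis. Removing the flat part
  changes the \<open>a\<^sub>i\<close> but not the \<open>x\<^sub>i\<close>. For \<open>B\<close> the condition \<open>a\<^sub>i = 0\<close> forces \<open>h' = \<tau>' = 0\<close>, so
  \<open>4 x\<^sub>i = i (d - i + 1) \<mu>'\<^sup>2\<close>; for \<open>A\<close> the \<open>x\<^sub>i\<close> involve the square of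
  \<open>2 \<tau> + h \<mu>\<^sup>* (2 i - d - 1)\<close>, and equality for \<open>i = 1, 2, 3\<close> gives \<open>h = 0\<close> and the equation for \<open>\<tau>\<close>.

  Conversely take \<open>A = B + \<delta> + s (A\<^sup>* - \<delta>\<^sup>*)\<close> with \<open>s = 2 \<tau> / \<mu>\<^sup>*\<^sup>2\<close>. Up to scalars, \<open>B\<close> and \<open>A\<^sup>*\<close> act on
  the binary forms of degree \<open>d\<close> as derivations, that is, through \<open>2 \<times> 2\<close> matrices, and hence so does
  \<open>A\<close>. The eigenbasis of \<open>A\<close> and both split bases consist, up to rescaling, of the products
  \<open>p\<^bsup>d-i\<^esup> q\<^sup>i\<close> for suitable linear forms \<open>p\<close> and \<open>q\<close>.
\<close>

section \<open>Coordinates with respect to an ordered basis\<close>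

text \<open>\<open>representation\<close> is indexed by the basis vectors; indexing by position lets
  coordinates be summed over \<open>0..d\<close> alongside the matrix entries of
  \<open>represents\<close>.\<close>

definition coord ::
  "('f::field \<Rightarrow> 'v::ab_group_add \<Rightarrow> 'v) \<Rightarrow> nat \<Rightarrow> (nat \<Rightarrow> 'v) \<Rightarrow> 'v \<Rightarrow> nat \<Rightarrow> 'f" where
  "coord scale d b v i = module.representation scale (b ` {0..d}) v (b i)"

context vector_space
begin

lemma linear_add_eq: "Vector_Spaces.linear scale scale L \<Longrightarrow> L (x + y) = L x + L y"
  by (simp add: module_hom_iff_linear[symmetric] module_hom_iff)

lemma linear_scale_eq: "Vector_Spaces.linear scale scale L \<Longrightarrow> L (c *s x) = c *s L x"
  by (simp add: module_hom_iff_linear[symmetric] module_hom_iff)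

lemma linear_sum_scale:
  assumes "Vector_Spaces.linear scale scale L"
  shows "L (\<Sum>i\<in>I. f i *s b i) = (\<Sum>i\<in>I. f i *s L (b i))"
proof -
  interpret module_hom scale scale L
    using assms by (simp add: module_hom_iff_linear)
  show ?thesis by (simp add: sum scale)
qed

lemma linearI:
  assumes "\<And>x y. L (x + y) = L x + L y" "\<And>c x. L (c *s x) = c *s L x"
  shows "Vector_Spaces.linear scale scale L"
  unfolding module_hom_iff_linear[symmetric] module_hom_iff
  using assms module_iff_vector_space[of scale] vector_space_axioms by blast

lemma sum_scale_delta:
  fixes d :: nat
  assumes "i \<le> d"
  shows "(\<Sum>j=0..d. (if j = i then c j else 0) *s b j) = c i *s b i"
proof -
  have "(\<Sum>j=0..d. (if j = i then c j else 0) *s b j) = (\<Sum>j=0..d. if i = j then c j *s b j else 0)"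
    by (intro sum.cong) auto
  also have "\<dots> = c i *s b i" using assms by simp
  finally show ?thesis .
qed

lemma coord_linear:
  assumes "ordered_basis scale d b"
  shows "coord scale d b (x + y) i = coord scale d b x i + coord scale d b y i"
    and "coord scale d b (c *s x) i = c * coord scale d b x i"
  using assms unfolding ordered_basis_def coord_def
  by (simp_all add: representation_add representation_scale)

lemma coord_basis:
  assumes "ordered_basis scale d b" "i \<le> d" "j \<le> d"
  shows "coord scale d b (b j) i = (if i = j then 1 else 0)"
  using assms unfolding ordered_basis_def coord_def
  by (auto simp add: representation_basis inj_on_eq_iff)

lemma coord_0:
  assumes "ordered_basis scale d b"
  shows "coord scale d b 0 i = 0"
  using coord_linear(2)[OF assms, of 0 0 i] by simp

lemma coord_sum_vectors:
  assumes "ordered_basis scale d b" "finite I"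
  shows "coord scale d b (\<Sum>k\<in>I. f k) i = (\<Sum>k\<in>I. coord scale d b (f k) i)"
  using assms(2)
  by (induction I rule: finite_induct)
    (simp_all add: coord_0[OF assms(1)] coord_linear[OF assms(1)])

lemma coord_combination:
  assumes b: "ordered_basis scale d b" and "i \<le> d"
  shows "coord scale d b (\<Sum>k=0..d. f k *s b k) i = f i"
proof -
  have "coord scale d b (\<Sum>k=0..d. f k *s b k) i = (\<Sum>k=0..d. if i = k then f k else 0)"
    unfolding coord_sum_vectors[OF b finite_atLeastAtMost] coord_linear[OF b]
    using \<open>i \<le> d\<close> by (intro sum.cong) (auto simp: coord_basis[OF b])
  also have "\<dots> = f i" using \<open>i \<le> d\<close> by simp
  finally show ?thesis .
qed

lemma sum_coord:
  assumes b: "ordered_basis scale d b"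
  shows "v = (\<Sum>i=0..d. coord scale d b v i *s b i)"
proof -
  have "(\<Sum>x\<in>b ` {0..d}. representation (b ` {0..d}) v x *s x) = v"
    using b unfolding ordered_basis_def by (intro sum_representation_eq) auto
  moreover have "(\<Sum>x\<in>b ` {0..d}. representation (b ` {0..d}) v x *s x)
      = (\<Sum>i=0..d. representation (b ` {0..d}) v (b i) *s b i)"
    using b unfolding ordered_basis_def by (subst sum.reindex) auto
  ultimately show ?thesis unfolding coord_def by simp
qed

lemma coord_eqI:
  assumes "ordered_basis scale d b" "\<And>i. i \<le> d \<Longrightarrow> coord scale d b v i = coord scale d b w i"
  shows "v = w"
proof -
  have "(\<Sum>i=0..d. coord scale d b v i *s b i) = (\<Sum>i=0..d. coord scale d b w i *s b i)"
    using assms(2) by simp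
  then show ?thesis by (simp only: sum_coord[OF assms(1), symmetric])
qed

lemma linear_eq_on_basis:
  assumes b: "ordered_basis scale d b" and "Vector_Spaces.linear scale scale L" "Vector_Spaces.linear scale scale M"
    and "\<And>i. i \<le> d \<Longrightarrow> L (b i) = M (b i)"
  shows "L v = M v"
proof -
  have "L v = (\<Sum>i=0..d. coord scale d b v i *s L (b i))"
    using arg_cong[OF sum_coord[OF b, of v], of L] by (simp only: linear_sum_scale[OF assms(2)])
  also have "\<dots> = (\<Sum>i=0..d. coord scale d b v i *s M (b i))"
    using assms(4) by simp
  also have "\<dots> = M v"
    using arg_cong[OF sum_coord[OF b, of v], of M] by (simp only: linear_sum_scale[OF assms(3)])
  finally show ?thesis .
qed

lemma basis_vector_nonzero:
  assumes "ordered_basis scale d b" "i \<le> d"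
  shows "b i \<noteq> 0"
  using coord_basis[OF assms(1,2,2)] coord_0[OF assms(1), of i] by auto

text \<open>A spanning list of \<open>d + 1\<close> vectors in dimension \<open>d + 1\<close> has no
  repetition, and a basis extracted from it must use all of it. The bases constructed below thus
  only need a check of spanning.\<close>

lemma ordered_basis_of_spanning:
  assumes dim: "dim (UNIV :: 'b set) = d + 1" and sp: "span (b ` {0..d}) = UNIV"
  shows "ordered_basis scale d b"
proof -
  have le: "card (b ` {0..d}) \<le> d + 1"
    using card_image_le[of "{0..d}" b] by simp
  moreover have "d + 1 \<le> card (b ` {0..d})"
    using dim_le_card[of UNIV "b ` {0..d}"] sp dim by simp
  ultimately have card: "card (b ` {0..d}) = d + 1" by simp
  then have inj: "inj_on b {0..d}" by (intro eq_card_imp_inj_on) auto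
  obtain C where C: "C \<subseteq> b ` {0..d}" "independent C" "b ` {0..d} \<subseteq> span C"
    using maximal_independent_subset by blast
  have "span C = UNIV" using C(3) sp span_mono span_span by (metis top.extremum_uniqueI)
  then have "card C = d + 1"
    using dim_eq_card_independent[OF C(2)] dim_span[of C] dim by simp
  then have "C = b ` {0..d}" using C(1) card by (intro card_subset_eq) auto
  with C(2) inj sp show ?thesis unfolding ordered_basis_def by simp
qed

section \<open>Eigenbases and the flat part\<close>

lemma eigenvector_coord_eq_0:
  assumes w: "ordered_basis scale d w" and L: "Vector_Spaces.linear scale scale L"
    and eig: "\<And>i. i \<le> d \<Longrightarrow> L (w i) = x i *s w i"
    and v: "L v = y *s v" and "i \<le> d" "x i \<noteq> y"
  shows "coord scale d w v i = 0"
proof -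
  have "L v = (\<Sum>j=0..d. (coord scale d w v j * x j) *s w j)"
    using arg_cong[OF sum_coord[OF w, of v], of L] by (simp add: linear_sum_scale[OF L] eig)
  then have "coord scale d w (L v) i = coord scale d w v i * x i"
    using coord_combination[OF w \<open>i \<le> d\<close>] by simp
  moreover have "coord scale d w (L v) i = y * coord scale d w v i"
    by (simp add: v coord_linear[OF w])
  ultimately show ?thesis using \<open>x i \<noteq> y\<close> by (simp add: mult.commute)
qed

lemma eigenvalues_eigenbasis:
  assumes w: "ordered_basis scale d w" and L: "Vector_Spaces.linear scale scale L"
    and eig: "\<And>i. i \<le> d \<Longrightarrow> L (w i) = x i *s w i"
  shows "eigenvalues scale L = x ` {0..d}"
proof
  show "x ` {0..d} \<subseteq> eigenvalues scale L"
    using eig basis_vector_nonzero[OF w]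
    by (fastforce simp: eigenvalues_def eigenspace_def)
  show "eigenvalues scale L \<subseteq> x ` {0..d}"
  proof
    fix y assume "y \<in> eigenvalues scale L"
    then obtain v where v: "L v = y *s v" "v \<noteq> 0"
      by (auto simp: eigenvalues_def eigenspace_def)
    obtain i where "i \<le> d" "coord scale d w v i \<noteq> 0"
      using v(2) coord_eqI[OF w, of v 0] coord_0[OF w] by metis
    then show "y \<in> x ` {0..d}"
      using eigenvector_coord_eq_0[OF w L eig v(1)] by force
  qed
qed

text \<open>Distinct eigenvalues make every eigenspace a line, so the projection is a coordinate
  map. The defining conditions fix its values on the eigenbasis, since each \<open>w j\<close> with
  \<open>j \<noteq> i\<close> belongs to another eigenvalue; this is the uniqueness that the
  definite description requires.\<close>

lemma primitive_idempotent_eigenbasis: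
  assumes w: "ordered_basis scale d w" and L: "Vector_Spaces.linear scale scale L"
    and eig: "\<And>i. i \<le> d \<Longrightarrow> L (w i) = x i *s w i"
    and inj: "inj_on x {0..d}" and i: "i \<le> d"
  shows "primitive_idempotent scale L (x i) = (\<lambda>v. coord scale d w v i *s w i)"
  unfolding primitive_idempotent_def
proof (rule the_equality)
  let ?E = "\<lambda>v. coord scale d w v i *s w i"
  let ?S = "\<Union>y\<in>eigenvalues scale L - {x i}. eigenspace scale L y"
  have lin: "Vector_Spaces.linear scale scale ?E"
    by (rule linearI) (simp_all add: coord_linear[OF w] scale_left_distrib)
  have fix_i: "?E v = v" if "v \<in> eigenspace scale L (x i)" for v
  proof -
    have "coord scale d w v j = 0" if "j \<le> d" "j \<noteq> i" for j
      using eigenvector_coord_eq_0[OF w L eig, of v "x i" j] that \<open>v \<in> _\<close> inj i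
      by (auto simp: eigenspace_def inj_on_eq_iff)
    then show ?thesis
      by (intro coord_eqI[OF w]) (auto simp: coord_linear[OF w] coord_basis[OF w _ i])
  qed
  have kill: "?E v = 0" if "v \<in> span ?S" for v
  proof -
    interpret module_hom scale scale ?E using lin by (simp add: module_hom_iff_linear)
    show ?thesis
    proof (rule eq_0_on_span[OF _ that])
      fix v assume "v \<in> ?S"
      then show "?E v = 0"
        using eigenvector_coord_eq_0[OF w L eig _ i, of v] by (auto simp: eigenspace_def)
    qed
  qed
  show "Vector_Spaces.linear scale scale ?E \<and> (\<forall>v\<in>eigenspace scale L (x i). ?E v = v) \<and>
      (\<forall>v\<in>span ?S. ?E v = 0)"
    using lin fix_i kill by blast
  fix E
  assume E: "Vector_Spaces.linear scale scale E \<and> (\<forall>v\<in>eigenspace scale L (x i). E v = v) \<and>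
      (\<forall>v\<in>span ?S. E v = 0)"
  have "E (w j) = ?E (w j)" if j: "j \<le> d" for j
  proof (cases "j = i")
    case True
    then show ?thesis using E eig[OF i] coord_basis[OF w i i] by (simp add: eigenspace_def)
  next
    case False
    then have "x j \<noteq> x i" using inj i j by (auto simp: inj_on_eq_iff)
    moreover have "x j \<in> eigenvalues scale L"
      using j eigenvalues_eigenbasis[OF w L eig] by auto
    ultimately have "w j \<in> ?S" using eig[OF j] by (auto simp: eigenspace_def)
    then have "w j \<in> span ?S" by (rule span_base)
    then have "E (w j) = 0" using E by simp
    then show ?thesis using coord_basis[OF w i j] False by simp
  qed
  then show "E = ?E" using linear_eq_on_basis[OF w _ lin] E by blast
qed

text \<open>Compressing \<open>A\<close> to the line of \<open>w i\<close> retains just the entry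
  \<open>T i i\<close>, so the flat part is the diagonal part of \<open>T\<close>.\<close>

lemma flat_part_eigenbasis:
  assumes w: "ordered_basis scale d w" and L: "Vector_Spaces.linear scale scale L"
    and eig: "\<And>i. i \<le> d \<Longrightarrow> L (w i) = x i *s w i"
    and inj: "inj_on x {0..d}" and A: "Vector_Spaces.linear scale scale A" and T: "represents scale d w A T"
  shows "flat_part scale A L v = (\<Sum>i=0..d. (T i i * coord scale d w v i) *s w i)"
proof -
  have "flat_part scale A L v =
      (\<Sum>i=0..d. primitive_idempotent scale L (x i) (A (primitive_idempotent scale L (x i) v)))"
    unfolding flat_part_def eigenvalues_eigenbasis[OF w L eig, simplified]
    by (subst sum.reindex[OF inj]) simp
  also have "\<dots> = (\<Sum>i=0..d. (T i i * coord scale d w v i) *s w i)"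
  proof (rule sum.cong[OF refl])
    fix i assume "i \<in> {0..d}"
    then have i: "i \<le> d" by simp
    then have "coord scale d w (A (w i)) i = T i i"
      using T coord_combination[OF w i] by (simp add: represents_def)
    then show "primitive_idempotent scale L (x i) (A (primitive_idempotent scale L (x i) v))
        = (T i i * coord scale d w v i) *s w i"
      by (simp add: primitive_idempotent_eigenbasis[OF w L eig inj i] linear_scale_eq[OF A]
          coord_linear[OF w] mult.commute)
  qed
  finally show ?thesis .
qed

end

section \<open>Split bases and the tridiagonal entries\<close>

text \<open>Stated over a commutative monoid so that it serves scalar sums along rows and columns as
  well as sums of vectors. The guards are needed because \<open>j - 1\<close> is \<open>0\<close>
  for \<open>j = 0\<close>.\<close>

lemma sum_tridiagonal:
  fixes g :: "nat \<Rightarrow> 'a::comm_monoid_add"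
  assumes "j \<le> d" "\<And>k. k \<le> d \<Longrightarrow> Suc k < j \<or> Suc j < k \<Longrightarrow> g k = 0"
  shows "(\<Sum>k=0..d. g k) =
    g j + (if 0 < j then g (j - 1) else 0) + (if j < d then g (j + 1) else 0)"
proof -
  have "(\<Sum>k=0..d. g k) = (\<Sum>k=0..d. (if k = j then g j else 0)
      + (if Suc k = j then g (j - 1) else 0) + (if k = Suc j then g (j + 1) else 0))"
  proof (rule sum.cong[OF refl])
    fix k assume "k \<in> {0..d}"
    then have "k \<le> d" by simp
    consider "k = j" | "Suc k = j" | "k = Suc j" | "Suc k < j \<or> Suc j < k" by linarith
    then show "g k = (if k = j then g j else 0)
        + (if Suc k = j then g (j - 1) else 0) + (if k = Suc j then g (j + 1) else 0)"
      by cases (use assms(2)[OF \<open>k \<le> d\<close>] in auto)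
  qed
  also have "\<dots> = g j + (if 0 < j then g (j - 1) else 0) + (if j < d then g (j + 1) else 0)"
    using \<open>j \<le> d\<close> by (cases j) (auto simp: sum.distrib)
  finally show ?thesis .
qed

context vector_space
begin

lemma coord_represents:
  assumes b: "ordered_basis scale d b" and L: "Vector_Spaces.linear scale scale L"
    and M: "represents scale d b L M" and i: "i \<le> d"
  shows "coord scale d b (L v) i = (\<Sum>k=0..d. coord scale d b v k * M i k)"
proof -
  have "L v = (\<Sum>k=0..d. coord scale d b v k *s L (b k))"
    using arg_cong[OF sum_coord[OF b, of v], of L] by (simp only: linear_sum_scale[OF L])
  moreover have "coord scale d b (L (b k)) i = M i k" if "k \<le> d" for k
    using M that coord_combination[OF b i] by (simp add: represents_def)
  ultimately show ?thesis
    by (simp add: coord_sum_vectors[OF b] coord_linear[OF b])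
qed

lemma split_basis_tridiagonal_entries:
  assumes b: "ordered_basis scale d b" and w: "ordered_basis scale d w"
    and A: "Vector_Spaces.linear scale scale A" and As: "Vector_Spaces.linear scale scale As"
    and Ab: "represents scale d b A (lower_bidiag th)"
    and Asb: "represents scale d b As (upper_bidiag ths fsp)"
    and eig: "\<And>i. i \<le> d \<Longrightarrow> As (w i) = ths i *s w i"
    and inj: "inj_on ths {0..d}"
    and T: "represents scale d w A T" and tri: "irred_tridiagonal d T"
  \<comment> \<open>The eigenvector \<open>w i\<close> is proportional to \<open>b i + c i b (i - 1) + e i b (i - 2) + \<dots>\<close>.\<close>
  defines "c \<equiv> \<lambda>i. if 1 \<le> i \<and> i \<le> d then fsp i / (ths i - ths (i - 1)) else 0"
  defines "e \<equiv> \<lambda>i. if 2 \<le> i \<and> i \<le> d then fsp (i - 1) * c i / (ths i - ths (i - 2)) else 0"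
  shows "i \<le> d \<Longrightarrow> T i i = th i + c i - c (i + 1)"
    and "1 \<le> i \<Longrightarrow> i \<le> d \<Longrightarrow>
      T (i - 1) i * T i (i - 1) = c i * (th (i - 1) - T i i) + e i - e (i + 1)"
proof -
  \<comment> \<open>The columns of \<open>P\<close> are the eigenvectors \<open>w j\<close> in split
    coordinates. \<open>R1\<close> is the eigenvector equation for \<open>As\<close>;
    \<open>R2\<close> compares the expansions of \<open>A (w j)\<close> through the bidiagonal
    matrix and through \<open>T\<close>.\<close>
  define P where "P i j = coord scale d b (w j) i" for i j
  have neq: "ths i \<noteq> ths j" if "i \<le> d" "j \<le> d" "i \<noteq> j" for i j
    using inj that by (auto simp: inj_on_eq_iff)
  have R1: "(ths j - ths i) * P i j = (if i < d then fsp (i + 1) * P (i + 1) j else 0)"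
    if i: "i \<le> d" and j: "j \<le> d" for i j
  proof -
    have "ths j * P i j = coord scale d b (As (w j)) i"
      by (simp add: eig[OF j] coord_linear[OF b] P_def)
    also have "\<dots> = (\<Sum>k=0..d. P k j * upper_bidiag ths fsp i k)"
      unfolding coord_represents[OF b As Asb i] P_def ..
    also have "\<dots> = P i j * ths i + (if i < d then fsp (i + 1) * P (i + 1) j else 0)"
      by (subst sum_tridiagonal[OF i]) (auto simp: upper_bidiag_def)
    finally show ?thesis by (simp add: algebra_simps)
  qed
  have R2: "th i * P i j + (if 0 < i then P (i - 1) j else 0) =
      T j j * P i j + (if 0 < j then T (j - 1) j * P i (j - 1) else 0)
        + (if j < d then T (j + 1) j * P i (j + 1) else 0)"
    if i: "i \<le> d" and j: "j \<le> d" for i j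
  proof -
    have "coord scale d b (A (w j)) i = (\<Sum>k=0..d. P k j * lower_bidiag th i k)"
      unfolding coord_represents[OF b A Ab i] P_def ..
    also have "\<dots> = P i j * th i + (if 0 < i then P (i - 1) j else 0)"
      by (subst sum_tridiagonal[OF i]) (auto simp: lower_bidiag_def)
    finally have l: "coord scale d b (A (w j)) i
        = P i j * th i + (if 0 < i then P (i - 1) j else 0)" .
    have "coord scale d b (A (w j)) i = (\<Sum>k=0..d. T k j * P i k)"
      using T j unfolding represents_def P_def
      by (simp add: coord_sum_vectors[OF b] coord_linear[OF b])
    also have "\<dots> = T j j * P i j + (if 0 < j then T (j - 1) j * P i (j - 1) else 0)
        + (if j < d then T (j + 1) j * P i (j + 1) else 0)"
      using tri j unfolding irred_tridiagonal_def by (subst sum_tridiagonal[OF j]) auto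
    finally show ?thesis using l by (simp add: mult.commute)
  qed
  \<comment> \<open>\<open>R1\<close> read upwards from row \<open>d\<close>: the differences of
    eigenvalues do not vanish, so nothing stands below the diagonal.\<close>
  have upper: "P i j = 0" if "j < i" "i \<le> d" for i j
    using \<open>i \<le> d\<close> \<open>j < i\<close>
  proof (induction rule: inc_induct)
    case base
    then show ?case using R1[of d j] neq[of j d] by auto
  next
    case (step n)
    then show ?case using R1[of n j] neq[of j n] by auto
  qed
  \<comment> \<open>A zero on the diagonal would spread up the column through \<open>R1\<close> and
    make \<open>w j\<close> zero.\<close>
  have diag: "P j j \<noteq> 0" if j: "j \<le> d" for j
  proof
    assume 0: "P j j = 0"
    have "P i j = 0" if "i \<le> j" for i
      using that
    proof (induction rule: inc_induct)
      case base
      show ?case by (rule 0)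
    next
      case (step n)
      then show ?case using R1[of n j] neq[of j n] j by auto
    qed
    then have "P i j = 0" if "i \<le> d" for i using upper[of j i] that by (cases "i \<le> j") auto
    then have "w j = 0" using coord_eqI[OF b, of "w j" 0] by (simp add: P_def coord_0[OF b])
    then show False using basis_vector_nonzero[OF w j] by simp
  qed
  have c: "P (i - 1) i = c i * P i i" if "1 \<le> i" "i \<le> d" for i
    using R1[of "i - 1" i] neq[of i "i - 1"] that by (auto simp: c_def field_simps)
  have e: "P (i - 2) i = e i * P i i" if "2 \<le> i" "i \<le> d" for i
  proof -
    have *: "i - 2 + 1 = i - 1" using that by simp
    have "(ths i - ths (i - 2)) * P (i - 2) i = fsp (i - 1) * (c i * P i i)"
      using R1[of "i - 2" i] c[of i] that unfolding * by auto
    then show ?thesis using neq[of i "i - 2"] that by (simp add: e_def field_simps)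
  qed
  \<comment> \<open>Row \<open>i + 1\<close>, column \<open>i\<close> of \<open>R2\<close>. It
    measures the unknown scaling of consecutive eigenvectors by the subdiagonal of \<open>T\<close>,
    which is why the result involves only products of opposite entries.\<close>
  have sub: "P i i = T (i + 1) i * P (i + 1) (i + 1)" if "i < d" for i
    using R2[of "i + 1" i] upper[of i "i + 1"] upper[of "i - 1" "i + 1"] that by auto
  \<comment> \<open>For \<open>i = d\<close> both sides are zero because \<open>c (d + 1)\<close> is
    \<open>0\<close> by default; \<open>e (d + 1)\<close> is treated alike.\<close>
  have next_c: "(if i < d then T (i + 1) i * P i (i + 1) else 0) = c (i + 1) * P i i"
    if "i \<le> d" for i
    using sub[of i] c[of "i + 1"] that by (auto simp: c_def)
  have next_e: "(if i < d then T (i + 1) i * P (i - 1) (i + 1) else 0) = e (i + 1) * P i i"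
    if "1 \<le> i" "i \<le> d" for i
    using sub[of i] e[of "i + 1"] that by (auto simp: e_def)
  \<comment> \<open>Entry \<open>(i, i)\<close> of \<open>R2\<close>, divided by
    \<open>P i i\<close>; the default \<open>c 0 = 0\<close> covers the first row.\<close>
  show T_diag: "T i i = th i + c i - c (i + 1)" if i: "i \<le> d" for i
  proof -
    have "(th i + c i) * P i i = (T i i + c (i + 1)) * P i i"
      using R2[OF i i] next_c[OF i] c[of i] upper[of "i - 1" i] i
      by (cases "i = 0") (auto simp: algebra_simps c_def)
    then have "th i + c i = T i i + c (i + 1)" using diag[OF i] by simp
    then show ?thesis by (simp add: algebra_simps)
  qed
  \<comment> \<open>Entry \<open>(i - 1, i)\<close> of \<open>R2\<close>, divided by
    \<open>P i i\<close>; the default \<open>e 1 = 0\<close> covers the missing row above row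
    \<open>0\<close>.\<close>
  show "T (i - 1) i * T i (i - 1) = c i * (th (i - 1) - T i i) + e i - e (i + 1)"
    if i: "1 \<le> i" "i \<le> d" for i
  proof -
    have prev: "(if 0 < i - 1 then P (i - 1 - 1) i else 0) = e i * P i i"
      using e[of i] i by (cases "i = 1") (auto simp: e_def numeral_2_eq_2)
    have "(th (i - 1) * c i + e i) * P i i =
        (T i i * c i + T (i - 1) i * T i (i - 1) + e (i + 1)) * P i i"
      using R2[of "i - 1" i] prev next_e[OF i] c[OF i] sub[of "i - 1"] i
      by (simp add: algebra_simps)
    then have "th (i - 1) * c i + e i = T i i * c i + T (i - 1) i * T i (i - 1) + e (i + 1)"
      using diag[OF i(2)] by simp
    then show ?thesis by (simp add: algebra_simps)
  qed
qed

end

section \<open>Standard orderings and Krawtchouk type\<close>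

text \<open>Turning back would repeat the value two steps earlier, which injectivity forbids; hence
  every step keeps the direction of the first.\<close>

lemma path_direction_constant:
  fixes \<sigma> :: "nat \<Rightarrow> nat"
  assumes inj: "inj_on \<sigma> {0..d}"
    and step: "\<And>i. i < d \<Longrightarrow> \<sigma> (i + 1) = \<sigma> i + 1 \<or> \<sigma> i = \<sigma> (i + 1) + 1"
  shows "(\<forall>i<d. \<sigma> (i + 1) = \<sigma> i + 1) \<or> (\<forall>i<d. \<sigma> i = \<sigma> (i + 1) + 1)"
proof -
  have turn: "\<sigma> (i + 2) \<noteq> \<sigma> i" if "i + 1 < d" for i
    using inj that by (auto simp: inj_on_eq_iff)
  have "i < d \<longrightarrow> (\<sigma> (i + 1) = \<sigma> i + 1 \<longleftrightarrow> \<sigma> 1 = \<sigma> 0 + 1)" for i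
  proof (induction i)
    case (Suc i)
    show ?case using Suc step[of i] step[of "Suc i"] turn[of i] by auto
  qed simp
  then show ?thesis using step by (metis Suc_eq_plus1 n_not_Suc_n)
qed

context vector_space
begin

text \<open>
  Two standard orderings differ by an automorphism of the path \<open>0, \<dots>, d\<close>, hence at most by reversal.
\<close>

lemma standard_ordering_arithmetic_progression:
  assumes As: "Vector_Spaces.linear scale scale As" and A: "Vector_Spaces.linear scale scale A"
    and th: "standard_ordering scale d A As th"
    and th2: "standard_ordering scale d A As th2"
    and ap: "\<forall>i\<in>{1..d}. th i - th (i - 1) = c"
  shows "\<exists>c. \<forall>i\<in>{1..d}. th2 i - th2 (i - 1) = c"
proof -
  obtain b M where b: "ordered_basis scale d b" "represents scale d b A (diag_mat th)"
      "represents scale d b As M" "irred_tridiagonal d M"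
    using th unfolding standard_ordering_def by blast
  obtain b2 M2 where b2: "ordered_basis scale d b2" "represents scale d b2 A (diag_mat th2)"
      "represents scale d b2 As M2" "irred_tridiagonal d M2"
    using th2 unfolding standard_ordering_def by blast
  have inj: "inj_on th {0..d}" "inj_on th2 {0..d}" and im: "th2 ` {0..d} = th ` {0..d}"
    using th th2 unfolding standard_ordering_def bij_betw_def by auto
  have diag: "L (u i) = x i *s u i"
    if "represents scale d u L (diag_mat x)" "i \<le> d" for L u x i
    using that sum_scale_delta[of i d x u]
    by (simp add: represents_def diag_mat_def cong: if_cong)
  have eig: "A (b i) = th i *s b i" and eig2: "A (b2 i) = th2 i *s b2 i" if "i \<le> d" for i
    using diag[OF b(2) that] diag[OF b2(2) that] .
  \<comment> \<open>\<open>\<sigma>\<close> matches positions of equal eigenvalues. As the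
    eigenspaces are lines, \<open>b2 i\<close> is a multiple of
    \<open>b (\<sigma> i)\<close>.\<close>
  define \<sigma> where "\<sigma> i = inv_into {0..d} th (th2 i)" for i
  have \<sigma>: "\<sigma> i \<le> d" "th (\<sigma> i) = th2 i" if "i \<le> d" for i
  proof -
    have "th2 i \<in> th ` {0..d}" using im that by auto
    then show "\<sigma> i \<le> d" "th (\<sigma> i) = th2 i"
      unfolding \<sigma>_def using inv_into_into[of "th2 i" th "{0..d}"] f_inv_into_f[of "th2 i" th] by auto
  qed
  have inj_\<sigma>: "inj_on \<sigma> {0..d}"
    by (rule inj_onI) (use \<sigma> inj(2) in \<open>metis atLeastAtMost_iff inj_onD\<close>)
  define k where "k i = coord scale d b (b2 i) (\<sigma> i)" for i
  have b2_eq: "b2 i = k i *s b (\<sigma> i)" if i: "i \<le> d" for i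
  proof (rule coord_eqI[OF b(1)])
    fix j assume j: "j \<le> d"
    show "coord scale d b (b2 i) j = coord scale d b (k i *s b (\<sigma> i)) j"
    proof (cases "j = \<sigma> i")
      case True
      then show ?thesis using \<sigma>[OF i] by (simp add: coord_linear[OF b(1)] coord_basis[OF b(1)] k_def)
    next
      case False
      then have "th j \<noteq> th2 i" using inj(1) \<sigma>[OF i] j by (metis atLeastAtMost_iff inj_onD zero_le)
      then have "coord scale d b (b2 i) j = 0"
        using eigenvector_coord_eq_0[OF b(1) A eig eig2[OF i] j] by blast
      then show ?thesis using False j \<sigma>[OF i]
        by (simp add: coord_linear[OF b(1)] coord_basis[OF b(1)])
    qed
  qed
  have k: "k i \<noteq> 0" if "i \<le> d" for i
    using b2_eq[OF that] basis_vector_nonzero[OF b2(1) that] by auto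
  \<comment> \<open>Computed in both bases, a coordinate of \<open>As (b2 i)\<close> shows that
    \<open>M2\<close> is \<open>M\<close> with indices permuted by \<open>\<sigma>\<close> and
    entries rescaled by nonzero factors. Neighbours therefore go to neighbours.\<close>
  have M_eq: "k i * M (\<sigma> j) (\<sigma> i) = M2 j i * k j" if i: "i \<le> d" and j: "j \<le> d" for i j
  proof -
    have "coord scale d b (As (b2 i)) (\<sigma> j) = k i * M (\<sigma> j) (\<sigma> i)"
      using b(3) \<sigma>[OF i] \<sigma>[OF j] coord_combination[OF b(1), of "\<sigma> j"]
      by (simp add: b2_eq[OF i] linear_scale_eq[OF As] coord_linear[OF b(1)] represents_def)
    moreover have "coord scale d b (As (b2 i)) (\<sigma> j)
        = (\<Sum>l=0..d. M2 l i * coord scale d b (b2 l) (\<sigma> j))"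
      using b2(3) i by (simp add: represents_def coord_sum_vectors[OF b(1)] coord_linear[OF b(1)])
    moreover have "\<dots> = (\<Sum>l=0..d. if j = l then M2 l i * k l else 0)"
    proof (rule sum.cong[OF refl])
      fix l assume "l \<in> {0..d}"
      then have l: "l \<le> d" by simp
      have "\<sigma> j = \<sigma> l \<longleftrightarrow> j = l" using inj_\<sigma> j l by (auto simp: inj_on_eq_iff)
      then show "M2 l i * coord scale d b (b2 l) (\<sigma> j) = (if j = l then M2 l i * k l else 0)"
        using \<sigma>[OF l] \<sigma>[OF j]
        by (auto simp: b2_eq[OF l] coord_linear[OF b(1)] coord_basis[OF b(1)])
    qed
    ultimately show ?thesis using j by simp
  qed
  have step: "\<sigma> (i + 1) = \<sigma> i + 1 \<or> \<sigma> i = \<sigma> (i + 1) + 1" if i: "i < d" for i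
  proof -
    have "M (\<sigma> (i + 1)) (\<sigma> i) \<noteq> 0"
      using M_eq[of i "i + 1"] k[of i] k[of "i + 1"] b2(4) i by (auto simp: irred_tridiagonal_def)
    then have "\<not> (Suc (\<sigma> (i + 1)) < \<sigma> i \<or> Suc (\<sigma> i) < \<sigma> (i + 1))"
      using b(4) \<sigma>(1)[of i] \<sigma>(1)[of "i + 1"] i by (auto simp: irred_tridiagonal_def)
    moreover have "\<sigma> (i + 1) \<noteq> \<sigma> i" using inj_\<sigma> i by (auto simp: inj_on_eq_iff)
    ultimately show ?thesis by linarith
  qed
  from path_direction_constant[OF inj_\<sigma> step]
  consider "\<forall>i<d. \<sigma> (i + 1) = \<sigma> i + 1" | "\<forall>i<d. \<sigma> i = \<sigma> (i + 1) + 1" by blast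
  then show ?thesis
  proof cases
    case 1
    have "th2 i - th2 (i - 1) = c" if i: "i \<in> {1..d}" for i
    proof -
      have "\<sigma> i = \<sigma> (i - 1) + 1" using 1[rule_format, of "i - 1"] i by auto
      then show ?thesis using \<sigma>[of i] \<sigma>[of "i - 1"] bspec[OF ap, of "\<sigma> i"] i by auto
    qed
    then show ?thesis by blast
  next
    case 2
    \<comment> \<open>Reversal negates the common difference.\<close>
    have "th2 i - th2 (i - 1) = - c" if i: "i \<in> {1..d}" for i
    proof -
      have "\<sigma> (i - 1) = \<sigma> i + 1" using 2[rule_format, of "i - 1"] i by auto
      then show ?thesis using \<sigma>[of i] \<sigma>[of "i - 1"] bspec[OF ap, of "\<sigma> (i - 1)"] i by auto
    qed
    then show ?thesis by blast
  qed
qed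

text \<open>With \<open>0\<close> in the place of \<open>hs\<close>, the denominators in the
  split-basis formulas become \<open>\<mu>s\<close> and \<open>2 * \<mu>s\<close>. After clearing
  them, both entries are polynomials in \<open>i\<close>.\<close>

lemma krawtchouk_tridiagonal_entries:
  assumes b: "ordered_basis scale d b" and w: "ordered_basis scale d w"
    and A: "Vector_Spaces.linear scale scale A" and As: "Vector_Spaces.linear scale scale As"
    and Ab: "represents scale d b A (lower_bidiag th)"
    and Asb: "represents scale d b As (upper_bidiag ths fsp)"
    and eig: "\<And>i. i \<le> d \<Longrightarrow> As (w i) = ths i *s w i"
    and inj: "inj_on ths {0..d}"
    and T: "represents scale d w A T" and tri: "irred_tridiagonal d T"
    and pd: "primary_data_of_array d th ths fsp ssp \<delta> \<mu> h \<delta>s \<mu>s 0 \<tau>"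
    and two: "(2 :: 'a) \<noteq> 0" and \<mu>s: "\<mu>s \<noteq> 0"
  shows "i \<le> d \<Longrightarrow> 2 * \<mu>s * T i i = 2 * \<mu>s * \<delta> + 2 * \<tau> * (2 * of_nat i - of_nat d)
      + h * \<mu>s * (4 * of_nat i * (of_nat i - of_nat d) + of_nat d * (of_nat d - 1))"
    and "1 \<le> i \<Longrightarrow> i \<le> d \<Longrightarrow> 4 * \<mu>s\<^sup>2 * (T (i - 1) i * T i (i - 1)) =
      of_nat i * (of_nat d - of_nat i + 1) *
        (\<mu>\<^sup>2 * \<mu>s\<^sup>2 - (2 * \<tau> + h * \<mu>s * (2 * of_nat i - of_nat d - 1))\<^sup>2)"
proof -
  define c where "c \<equiv> \<lambda>i. if 1 \<le> i \<and> i \<le> d then fsp i / (ths i - ths (i - 1)) else 0"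
  define e where "e \<equiv> \<lambda>i. if 2 \<le> i \<and> i \<le> d then fsp (i - 1) * c i / (ths i - ths (i - 2)) else 0"
  have diag_entry: "T i i = th i + c i - c (i + 1)" if "i \<le> d" for i
    unfolding c_def
    by (rule split_basis_tridiagonal_entries(1)[OF b w A As Ab Asb _ inj T tri that]) (rule eig)
  have off_diag: "T (i - 1) i * T i (i - 1) = c i * (th (i - 1) - T i i) + e i - e (i + 1)"
    if "1 \<le> i" "i \<le> d" for i
    unfolding c_def e_def
    by (rule split_basis_tridiagonal_entries(2)[OF b w A As Ab Asb _ inj T tri that]) (rule eig)
  define n where "n = (of_nat d :: 'a)"
  \<comment> \<open>Twice the polynomial that gives the first split sequence, despite the letter.
    Its zeros at \<open>0\<close> and \<open>n + 1\<close> agree with the default values of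
    \<open>c\<close> and \<open>e\<close> at the ends.\<close>
  define \<phi> where "\<phi> x = x * (n - x + 1) * (2 * \<tau> - \<mu> * \<mu>s + h * \<mu>s * (2 * x - n - 1))" for x
  have th: "2 * th i = 2 * \<delta> + \<mu> * (2 * of_nat i - n) + 2 * h * of_nat i * (n - of_nat i)"
    if "i \<le> d" for i
    using pd that two unfolding primary_data_of_array_def n_def
    by (simp add: of_nat_diff field_simps)
  have ths: "ths i = \<delta>s + \<mu>s * (of_nat i - n / 2)" if "i \<le> d" for i
    using pd that unfolding primary_data_of_array_def n_def by simp
  have fsp: "2 * fsp i = \<phi> (of_nat i)" if i: "1 \<le> i" "i \<le> d" for i
  proof -
    \<comment> \<open>Naming the halves leaves a polynomial identity free of division.\<close>
    define p q where "p = \<mu> * \<mu>s / 2" and "q = (n + 1) / 2"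
    have pq: "2 * p = \<mu> * \<mu>s" "2 * q = n + 1" unfolding p_def q_def using two by simp_all
    have "fsp i = of_nat i * of_nat (d - i + 1) *
        (\<tau> - \<mu> * \<mu>s / 2 + h * \<mu>s * (of_nat i - of_nat (d + 1) / 2))"
      using pd i unfolding primary_data_of_array_def by simp
    also have "of_nat (d - i + 1) = n - of_nat i + 1" using i by (simp add: n_def of_nat_diff)
    also have "of_nat (d + 1) = n + 1" by (simp add: n_def)
    finally have "fsp i = of_nat i * (n - of_nat i + 1) * (\<tau> - p + h * \<mu>s * (of_nat i - q))"
      by (simp add: p_def q_def)
    then show ?thesis unfolding \<phi>_def using pq by algebra
  qed
  have c: "2 * \<mu>s * c i = \<phi> (of_nat i)" if id: "i \<le> d + 1" for i
  proof -
    consider "i = 0" | "1 \<le> i" "i \<le> d" | "i = d + 1" using id by linarith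
    then show ?thesis
    proof cases
      case 2
      then have "ths i - ths (i - 1) = \<mu>s" by (simp add: ths of_nat_diff algebra_simps)
      then show ?thesis using 2 fsp[OF 2] \<mu>s by (simp add: c_def)
    qed (auto simp: c_def \<phi>_def n_def)
  qed
  have e: "8 * \<mu>s\<^sup>2 * e i = \<phi> (of_nat i - 1) * \<phi> (of_nat i)" if id: "1 \<le> i" "i \<le> d + 1" for i
  proof -
    consider "i = 1" | "2 \<le> i" "i \<le> d" | "i = d + 1" using id by linarith
    then show ?thesis
    proof cases
      case 2
      then have "ths i - ths (i - 2) = 2 * \<mu>s" by (simp add: ths of_nat_diff algebra_simps)
      then have "e i = fsp (i - 1) * c i / (2 * \<mu>s)" using 2 by (simp add: e_def)
      then have "2 * \<mu>s * e i = fsp (i - 1) * c i" using two \<mu>s by simp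
      then have "8 * \<mu>s\<^sup>2 * e i = (2 * fsp (i - 1)) * (2 * \<mu>s * c i)" by algebra
      then show ?thesis using fsp[of "i - 1"] c[of i] 2 by (simp add: of_nat_diff)
    qed (auto simp: e_def \<phi>_def n_def)
  qed
  show diag: "2 * \<mu>s * T i i = 2 * \<mu>s * \<delta> + 2 * \<tau> * (2 * of_nat i - of_nat d)
      + h * \<mu>s * (4 * of_nat i * (of_nat i - of_nat d) + of_nat d * (of_nat d - 1))"
    if i: "i \<le> d" for i
  proof -
    have "2 * \<mu>s * T i i = \<mu>s * (2 * th i) + 2 * \<mu>s * c i - 2 * \<mu>s * c (i + 1)"
      unfolding diag_entry[OF i] by (simp add: algebra_simps)
    also have "\<dots> = \<mu>s * (2 * \<delta> + \<mu> * (2 * of_nat i - n) + 2 * h * of_nat i * (n - of_nat i))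
        + \<phi> (of_nat i) - \<phi> (of_nat i + 1)"
      using th[OF i] c[of i] c[of "i + 1"] i by (simp add: add.commute)
    also have "\<dots> = 2 * \<mu>s * \<delta> + 2 * \<tau> * (2 * of_nat i - n)
      + h * \<mu>s * (4 * of_nat i * (of_nat i - n) + n * (n - 1))"
      unfolding \<phi>_def by algebra
    finally show ?thesis by (simp add: n_def)
  qed
  show "4 * \<mu>s\<^sup>2 * (T (i - 1) i * T i (i - 1)) =
      of_nat i * (of_nat d - of_nat i + 1) *
        (\<mu>\<^sup>2 * \<mu>s\<^sup>2 - (2 * \<tau> + h * \<mu>s * (2 * of_nat i - of_nat d - 1))\<^sup>2)"
    if i: "1 \<le> i" "i \<le> d" for i
  proof -
    let ?x = "of_nat i :: 'a"
    \<comment> \<open>The extra factor \<open>2\<close> produces exactly the multiples of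
      \<open>th\<close>, \<open>c\<close> and \<open>e\<close> known in terms of
      \<open>\<phi>\<close>; it is cancelled at the end.\<close>
    have "2 * (4 * \<mu>s\<^sup>2 * (T (i - 1) i * T i (i - 1)))
        = 2 * \<mu>s * c i * (2 * \<mu>s * (2 * th (i - 1)) - 2 * (2 * \<mu>s * T i i))
          + 8 * \<mu>s\<^sup>2 * e i - 8 * \<mu>s\<^sup>2 * e (i + 1)"
      unfolding off_diag[OF i] by (simp add: algebra_simps power2_eq_square)
    also have "\<dots> = \<phi> ?x * (2 * \<mu>s * (2 * \<delta> + \<mu> * (2 * (?x - 1) - n) + 2 * h * (?x - 1) * (n - (?x - 1)))
          - 2 * (2 * \<mu>s * \<delta> + 2 * \<tau> * (2 * ?x - n) + h * \<mu>s * (4 * ?x * (?x - n) + n * (n - 1))))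
        + \<phi> (?x - 1) * \<phi> ?x - \<phi> ?x * \<phi> (?x + 1)"
      using th[of "i - 1"] c[of i] e[of i] e[of "i + 1"] diag[of i] i
      by (simp add: n_def of_nat_diff add.commute)
    also have "\<dots> = 2 * (?x * (n - ?x + 1) * (\<mu>\<^sup>2 * \<mu>s\<^sup>2 - (2 * \<tau> + h * \<mu>s * (2 * ?x - n - 1))\<^sup>2))"
      unfolding \<phi>_def by algebra
    finally show ?thesis unfolding mult_left_cancel[OF two] n_def .
  qed
qed

end

section \<open>Binary forms\<close>

text \<open>
  A polynomial \<open>f\<close> stands for the binary form of degree \<open>n\<close> in \<open>x\<close> and \<open>y\<close> that it becomes
  for \<open>y = 1\<close>. The derivation with \<open>x \<mapsto> a x + b y\<close> and \<open>y \<mapsto> c x + e y\<close> then involves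
  \<open>\<partial>f/\<partial>y = n f - x f'\<close>.
\<close>

definition form_derivation ::
  "'a \<Rightarrow> 'a \<Rightarrow> 'a \<Rightarrow> 'a \<Rightarrow> nat \<Rightarrow> 'a::field poly \<Rightarrow> 'a poly" where
  "form_derivation a b c e n f =
     [:b, a:] * pderiv f + [:e, c:] * (of_nat n * f - [:0, 1:] * pderiv f)"

lemma form_derivation_add:
  "form_derivation a b c e n (f + g) = form_derivation a b c e n f + form_derivation a b c e n g"
  unfolding form_derivation_def pderiv_add by (simp only: algebra_simps)

text \<open>Leibniz rule. The formal degree enters through Euler's relation, so it is additive in
  the factors.\<close>

lemma form_derivation_mult:
  "form_derivation a b c e (m + n) (f * g) =
     form_derivation a b c e m f * g + f * form_derivation a b c e n g"
  unfolding form_derivation_def pderiv_mult of_nat_add by (simp only: algebra_simps)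

lemma form_derivation_power:
  "form_derivation a b c e n (p ^ n) = of_nat n * p ^ (n - 1) * form_derivation a b c e 1 p"
proof (induction n)
  case 0
  show ?case by (simp add: form_derivation_def)
next
  case (Suc n)
  have "form_derivation a b c e (Suc n) (p ^ Suc n) =
      form_derivation a b c e 1 p * p ^ n + p * (of_nat n * p ^ (n - 1) * form_derivation a b c e 1 p)"
    using form_derivation_mult[of a b c e 1 n p "p ^ n"] Suc by simp
  also have "\<dots> = of_nat (Suc n) * p ^ n * form_derivation a b c e 1 p"
    by (cases n) (simp_all add: algebra_simps)
  finally show ?case by simp
qed

lemma form_derivation_linear:
  "form_derivation a b c e 1 [:p0, p1:] = [:b * p1 + e * p0, a * p1 + c * p0:]"
  by (simp add: form_derivation_def pderiv_pCons)

lemma form_derivation_monom: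
  assumes "i \<le> n"
  shows "form_derivation a b c e n (monom k i) = monom (k * (a * of_nat i + e * of_nat (n - i))) i
    + monom (k * b * of_nat i) (i - 1) + monom (k * c * of_nat (n - i)) (i + 1)"
proof (rule poly_eqI)
  fix j
  show "coeff (form_derivation a b c e n (monom k i)) j =
    coeff (monom (k * (a * of_nat i + e * of_nat (n - i))) i
      + monom (k * b * of_nat i) (i - 1) + monom (k * c * of_nat (n - i)) (i + 1)) j"
    unfolding form_derivation_def
    using assms
    by (cases i; cases j)
      (auto simp: pderiv_monom monom_0 coeff_pCons of_nat_diff of_nat_poly algebra_simps split: nat.splits)
qed

text \<open>By the Leibniz rule a 2 x 2 action on \<open>p\<close> and \<open>q\<close> becomes
  tridiagonal on their products. The subdiagonal vanishes with \<open>\<beta>\<close> and the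
  superdiagonal with \<open>\<gamma>\<close>, so triangular 2 x 2 matrices yield bidiagonal
  ones.\<close>

lemma form_derivation_frame:
  assumes p: "form_derivation a b c e 1 p = smult \<alpha> p + smult \<beta> q"
    and q: "form_derivation a b c e 1 q = smult \<gamma> p + smult \<epsilon> q" and i: "i \<le> d"
  shows "form_derivation a b c e d (p ^ (d - i) * q ^ i) =
    smult (of_nat (d - i) * \<alpha> + of_nat i * \<epsilon>) (p ^ (d - i) * q ^ i)
    + smult (of_nat (d - i) * \<beta>) (p ^ (d - (i + 1)) * q ^ (i + 1))
    + smult (of_nat i * \<gamma>) (p ^ (d - (i - 1)) * q ^ (i - 1))"
proof -
  have sm: "smult k f = [:k:] * f" for k :: 'a and f by simp
  have "form_derivation a b c e d (p ^ (d - i) * q ^ i) =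
      of_nat (d - i) * p ^ (d - i - 1) * ([:\<alpha>:] * p + [:\<beta>:] * q) * q ^ i
      + p ^ (d - i) * (of_nat i * q ^ (i - 1) * ([:\<gamma>:] * p + [:\<epsilon>:] * q))"
    using form_derivation_mult[of a b c e "d - i" i "p ^ (d - i)" "q ^ i"] i
    unfolding form_derivation_power p q sm by simp
  also have "of_nat (d - i) * p ^ (d - i - 1) * ([:\<alpha>:] * p + [:\<beta>:] * q) * q ^ i
      = [:of_nat (d - i) * \<alpha>:] * (p ^ (d - i) * q ^ i)
        + [:of_nat (d - i) * \<beta>:] * (p ^ (d - (i + 1)) * q ^ (i + 1))"
  proof (cases "d - i")
    case (Suc j)
    then have "d - (i + 1) = j" by simp
    then show ?thesis using Suc by (simp add: of_nat_poly algebra_simps smult_add_left)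
  qed simp
  also have "p ^ (d - i) * (of_nat i * q ^ (i - 1) * ([:\<gamma>:] * p + [:\<epsilon>:] * q))
      = [:of_nat i * \<epsilon>:] * (p ^ (d - i) * q ^ i)
        + [:of_nat i * \<gamma>:] * (p ^ (d - (i - 1)) * q ^ (i - 1))"
  proof (cases i)
    case (Suc j)
    then have "d - j = Suc (d - i)" using i by simp
    then show ?thesis using Suc by (simp add: of_nat_poly algebra_simps smult_add_left)
  qed simp
  finally show ?thesis by (simp add: smult_add_left algebra_simps)
qed

text \<open>Induction on the degree: split \<open>f\<close> as \<open>k\<close> times a power of y
  plus x times \<open>g\<close>, and express x and y through \<open>p\<close> and \<open>q\<close>,
  which the determinant allows.\<close>

lemma forms_spanned_by_frame:
  fixes p q f :: "'a::field poly"
  assumes p: "p = [:p0, p1:]" and q: "q = [:q0, q1:]" and det: "p0 * q1 \<noteq> p1 * q0"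
    and "degree f \<le> n"
  shows "\<exists>c. f = (\<Sum>i=0..n. smult (c i) (p ^ (n - i) * q ^ i))"
  using \<open>degree f \<le> n\<close>
proof (induction n arbitrary: f)
  case 0
  then obtain k where "f = [:k:]" by (metis degree_eq_zeroE le_zero_eq)
  then show ?case by (intro exI[of _ "\<lambda>_. k"]) simp
next
  case (Suc n)
  obtain k g where f: "f = pCons k g" by (cases f)
  have g: "degree g \<le> n" using Suc.prems unfolding f by (cases "g = 0") simp_all
  define D where "D = p0 * q1 - p1 * q0"
  have D: "D \<noteq> 0" using det by (simp add: D_def)
  \<comment> \<open>Cramer's rule: \<open>1\<close> (standing for y) is
    \<open>(q1 p - p1 q) / D\<close> and x is \<open>(p0 q - q0 p) / D\<close>. Collecting terms
    gives \<open>f = p * g1 + q * g2\<close>.\<close>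
  define g1 where "g1 = smult (q1 / D) [:k:] + smult (- q0 / D) g"
  define g2 where "g2 = smult (- p1 / D) [:k:] + smult (p0 / D) g"
  have "degree g1 \<le> n" "degree g2 \<le> n"
    unfolding g1_def g2_def
    by (rule degree_add_le; use g in \<open>auto intro: order.trans[OF degree_smult_le]\<close>)+
  with Suc.IH obtain c1 c2
    where c1: "g1 = (\<Sum>i=0..n. smult (c1 i) (p ^ (n - i) * q ^ i))"
      and c2: "g2 = (\<Sum>i=0..n. smult (c2 i) (p ^ (n - i) * q ^ i))" by blast
  have inv: "p0 * q1 / D - p1 * q0 / D = 1"
    using D by (simp add: D_def diff_divide_distrib[symmetric])
  have one: "smult (q1 / D) p + smult (- p1 / D) q = 1"
    unfolding p q one_pCons by (simp, simp add: inv mult.commute)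
  have var: "smult (- q0 / D) p + smult (p0 / D) q = [:0, 1:]"
    unfolding p q by (simp, simp add: inv mult.commute)
  have "f = [:k:] * 1 + [:0, 1:] * g" by (simp add: f)
  also have "\<dots> = p * g1 + q * g2"
    unfolding one[symmetric] var[symmetric] g1_def g2_def by (simp add: algebra_simps)
  also have "p * g1 = (\<Sum>i=0..n. smult (c1 i) (p ^ (Suc n - i) * q ^ i))"
    unfolding c1 sum_distrib_left by (intro sum.cong) (auto simp: Suc_diff_le algebra_simps)
  also have "\<dots> = (\<Sum>i=0..Suc n. smult (if i \<le> n then c1 i else 0) (p ^ (Suc n - i) * q ^ i))"
    by simp
  also have "q * g2 = (\<Sum>i=0..n. smult (c2 i) (p ^ (n - i) * q ^ Suc i))"
    unfolding c2 sum_distrib_left by (intro sum.cong) (auto simp: algebra_simps)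
  also have "\<dots> = (\<Sum>i=0..Suc n. smult (if 0 < i then c2 (i - 1) else 0) (p ^ (Suc n - i) * q ^ i))"
    by (subst sum.atLeast0_atMost_Suc_shift) simp
  finally have "f = (\<Sum>i=0..Suc n. smult ((if i \<le> n then c1 i else 0)
      + (if 0 < i then c2 (i - 1) else 0)) (p ^ (Suc n - i) * q ^ i))"
    unfolding sum.distrib[symmetric] smult_add_left .
  then show ?case
    by (intro exI[of _ "\<lambda>i. (if i \<le> n then c1 i else 0) + (if 0 < i then c2 (i - 1) else 0)"])
qed

section \<open>Transport of binary forms to the vector space\<close>

definition form_vector ::
  "('f::field \<Rightarrow> 'v::ab_group_add \<Rightarrow> 'v) \<Rightarrow> nat \<Rightarrow> (nat \<Rightarrow> 'v) \<Rightarrow> 'f poly \<Rightarrow> 'v" where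
  "form_vector scale d W f = (\<Sum>i=0..d. scale (coeff f i) (W i))"

context vector_space
begin

lemma form_vector_add: "form_vector scale d W (f + g) = form_vector scale d W f + form_vector scale d W g"
  by (simp add: form_vector_def scale_left_distrib sum.distrib)

lemma form_vector_smult: "form_vector scale d W (smult k f) = k *s form_vector scale d W f"
  by (simp add: form_vector_def scale_sum_right)

lemma form_vector_sum: "form_vector scale d W (\<Sum>i\<in>I. f i) = (\<Sum>i\<in>I. form_vector scale d W (f i))"
  by (induction I rule: infinite_finite_induct)
    (simp_all add: form_vector_add, simp_all add: form_vector_def)

lemma form_vector_monom: "i \<le> d \<Longrightarrow> form_vector scale d W (monom k i) = k *s W i"
  using sum_scale_delta[of i d "\<lambda>_. k" W] by (simp add: form_vector_def eq_commute cong: if_cong)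

text \<open>\<open>form_vector\<close> sends the form x^i y^(d-i) to \<open>W i\<close>, so the
  assumption on \<open>W\<close> says that \<open>L\<close> acts on monomials as
  \<open>\<kappa>\<close> plus a derivation; additivity extends this to all forms.\<close>

lemma form_vector_intertwines:
  assumes L: "Vector_Spaces.linear scale scale L"
    and W: "\<And>i. i \<le> d \<Longrightarrow> L (W i) = (\<kappa> + a * of_nat i + e * of_nat (d - i)) *s W i
      + (b * of_nat i) *s W (i - 1) + (c * of_nat (d - i)) *s W (i + 1)"
    and f: "degree f \<le> d"
  shows "L (form_vector scale d W f) =
    \<kappa> *s form_vector scale d W f + form_vector scale d W (form_derivation a b c e d f)"
proof -
  let ?v = "form_vector scale d W" and ?D = "form_derivation a b c e d"
  have monom: "L (?v (monom k i)) = \<kappa> *s ?v (monom k i) + ?v (?D (monom k i))" if i: "i \<le> d" for i k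
  proof -
    \<comment> \<open>For \<open>i = d\<close> the vector \<open>W (d + 1)\<close> is outside the
      basis, but its coefficient is \<open>0\<close>.\<close>
    have up: "?v (monom (k * c * of_nat (d - i)) (i + 1)) = (k * c * of_nat (d - i)) *s W (i + 1)"
    proof (cases "i = d")
      case True
      then show ?thesis by (simp add: form_vector_def)
    next
      case False
      then show ?thesis using i by (intro form_vector_monom) simp
    qed
    show ?thesis
      unfolding form_derivation_monom[OF i] form_vector_add up
      using i by (simp add: form_vector_monom linear_scale_eq[OF L] W[OF i] scale_right_distrib
          scale_left_distrib algebra_simps)
  qed
  have "L (?v (\<Sum>i\<le>m. monom (coeff f i) i)) = \<kappa> *s ?v (\<Sum>i\<le>m. monom (coeff f i) i)
      + ?v (?D (\<Sum>i\<le>m. monom (coeff f i) i))" if "m \<le> d" for m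
    using that
  proof (induction m)
    case 0
    show ?case using monom[of 0] by simp
  next
    case (Suc m)
    show ?case
      using Suc.IH Suc.prems monom[OF Suc.prems]
      by (simp add: form_vector_add form_derivation_add linear_add_eq[OF L] scale_right_distrib
          algebra_simps)
  qed
  from this[of d] show ?thesis using poly_as_sum_of_monoms'[OF f] by simp
qed

text \<open>\<open>Dp\<close> and \<open>Dq\<close> state, coefficient by coefficient, how the
  derivation acts on the frame \<open>p\<close>, \<open>q\<close>. Finding a basis in which
  \<open>L\<close> has a given shape is thereby a 2 x 2 problem.\<close>

lemma frame_vector_image:
  assumes L: "Vector_Spaces.linear scale scale L"
    and W: "\<And>i. i \<le> d \<Longrightarrow> L (W i) = (\<kappa> + a * of_nat i + e * of_nat (d - i)) *s W i
      + (b * of_nat i) *s W (i - 1) + (c * of_nat (d - i)) *s W (i + 1)"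
    and p: "p = [:p0, p1:]" and q: "q = [:q0, q1:]"
    and Dp: "b * p1 + e * p0 = \<alpha> * p0 + \<beta> * q0" "a * p1 + c * p0 = \<alpha> * p1 + \<beta> * q1"
    and Dq: "b * q1 + e * q0 = \<gamma> * p0 + \<epsilon> * q0" "a * q1 + c * q0 = \<gamma> * p1 + \<epsilon> * q1"
    and i: "i \<le> d"
  defines "u \<equiv> \<lambda>i. form_vector scale d W (p ^ (d - i) * q ^ i)"
  shows "L (u i) = (\<kappa> + of_nat (d - i) * \<alpha> + of_nat i * \<epsilon>) *s u i
    + (of_nat (d - i) * \<beta>) *s u (i + 1) + (of_nat i * \<gamma>) *s u (i - 1)"
proof -
  have "degree (p ^ (d - i) * q ^ i) \<le> 1 * (d - i) + 1 * i"
    unfolding p q by (intro order.trans[OF degree_mult_le] add_mono order.trans[OF degree_power_le]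
        mult_right_mono) (auto simp: degree_pCons_eq_if)
  then have deg: "degree (p ^ (d - i) * q ^ i) \<le> d" using i by simp
  have "form_derivation a b c e 1 p = smult \<alpha> p + smult \<beta> q"
      "form_derivation a b c e 1 q = smult \<gamma> p + smult \<epsilon> q"
    unfolding p q form_derivation_linear using Dp Dq by simp_all
  from form_vector_intertwines[OF L W deg, unfolded form_derivation_frame[OF this i]] show ?thesis
    unfolding u_def
    by (simp only: form_vector_add form_vector_smult scale_left_distrib add.assoc)
qed

lemma frame_ordered_basis:
  assumes W: "ordered_basis scale d W" and dim: "dim (UNIV :: 'b set) = d + 1"
    and p: "p = [:p0, p1:]" and q: "q = [:q0, q1:]" and det: "p0 * q1 \<noteq> p1 * q0"
  shows "ordered_basis scale d (\<lambda>i. form_vector scale d W (p ^ (d - i) * q ^ i))"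
    (is "ordered_basis scale d ?u")
proof (rule ordered_basis_of_spanning[OF dim])
  have "v \<in> span (?u ` {0..d})" for v
  proof -
    define f where "f = (\<Sum>i\<le>d. monom (coord scale d W v i) i)"
    have "degree f \<le> d" unfolding f_def
      by (intro degree_sum_le) (auto intro: order.trans[OF degree_monom_le])
    with forms_spanned_by_frame[OF p q det] obtain c
      where c: "f = (\<Sum>i=0..d. smult (c i) (p ^ (d - i) * q ^ i))" by blast
    have "v = form_vector scale d W f"
      using sum_coord[OF W, of v]
      by (simp add: f_def form_vector_sum form_vector_monom atLeast0AtMost)
    also have "\<dots> = (\<Sum>i=0..d. c i *s ?u i)"
      by (simp add: c form_vector_sum form_vector_smult)
    also have "\<dots> \<in> span (?u ` {0..d})"
      by (intro span_sum span_scale span_base) auto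
    finally show ?thesis .
  qed
  then show "span (?u ` {0..d}) = UNIV" by blast
qed

lemma ordered_basis_rescale:
  assumes dim: "dim (UNIV :: 'b set) = d + 1" and w: "ordered_basis scale d w"
    and k: "\<And>i. i \<le> d \<Longrightarrow> k i \<noteq> 0"
  shows "ordered_basis scale d (\<lambda>i. k i *s w i)"
proof (rule ordered_basis_of_spanning[OF dim])
  let ?S = "span ((\<lambda>i. k i *s w i) ` {0..d})"
  have "w i \<in> ?S" if "i \<le> d" for i
  proof -
    have "inverse (k i) *s (k i *s w i) \<in> ?S" using that by (intro span_scale span_base) auto
    then show ?thesis using k[OF that] by simp
  qed
  then have "span (w ` {0..d}) \<subseteq> ?S" by (intro span_minimal) auto
  then show "?S = UNIV" using w unfolding ordered_basis_def by auto
qed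

section \<open>Matrices read as images of basis vectors\<close>

lemma represents_tridiagonal:
  assumes "\<And>i j. i \<le> d \<Longrightarrow> j \<le> d \<Longrightarrow> Suc i < j \<or> Suc j < i \<Longrightarrow> M i j = 0"
  shows "represents scale d u L M \<longleftrightarrow> (\<forall>j\<le>d. L (u j) = M j j *s u j
    + (if 0 < j then M (j - 1) j *s u (j - 1) else 0)
    + (if j < d then M (j + 1) j *s u (j + 1) else 0))"
proof -
  have "(\<Sum>i=0..d. M i j *s u i) = M j j *s u j
    + (if 0 < j then M (j - 1) j *s u (j - 1) else 0)
    + (if j < d then M (j + 1) j *s u (j + 1) else 0)" if "j \<le> d" for j
    by (rule sum_tridiagonal[OF that]) (use assms that in auto)
  then show ?thesis by (simp add: represents_def)
qed

lemma represents_diag_mat: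
  "represents scale d u L (diag_mat x) \<longleftrightarrow> (\<forall>j\<le>d. L (u j) = x j *s u j)"
proof -
  have "(\<Sum>i=0..d. diag_mat x i j *s u i) = x j *s u j" if "j \<le> d" for j
    by (subst sum_tridiagonal[OF that]; cases j) (auto simp: diag_mat_def)
  then show ?thesis by (simp add: represents_def)
qed

lemma represents_lower_bidiag:
  "represents scale d u L (lower_bidiag x) \<longleftrightarrow>
    (\<forall>j\<le>d. L (u j) = x j *s u j + (if j < d then u (j + 1) else 0))"
proof -
  have "(\<Sum>i=0..d. lower_bidiag x i j *s u i) = x j *s u j + (if j < d then u (j + 1) else 0)" if "j \<le> d" for j
    by (subst sum_tridiagonal[OF that]; cases j) (auto simp: lower_bidiag_def)
  then show ?thesis by (simp add: represents_def)
qed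

lemma represents_upper_bidiag:
  "represents scale d u L (upper_bidiag x y) \<longleftrightarrow>
    (\<forall>j\<le>d. L (u j) = x j *s u j + (if 0 < j then y j *s u (j - 1) else 0))"
proof -
  have "(\<Sum>i=0..d. upper_bidiag x y i j *s u i) = x j *s u j + (if 0 < j then y j *s u (j - 1) else 0)" if "j \<le> d" for j
    by (subst sum_tridiagonal[OF that]; cases j) (auto simp: upper_bidiag_def)
  then show ?thesis by (simp add: represents_def)
qed

text \<open>The frame is p = y, an eigenvector of the 2 x 2 matrix of \<open>As\<close>, and q, an
  eigenvector of that of \<open>A\<close> for \<open>\<rho>\<close>. Then \<open>A\<close> sends p
  to -\<rho> p + q and \<open>As\<close> sends q to ms q + 2 ms (t - \<rho>) p. Either square root
  may serve as \<open>\<rho>\<close>; the two choices give the two split sequences.\<close>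

lemma krawtchouk_split_basis:
  assumes dim: "dim (UNIV :: 'b set) = d + 1" and W: "ordered_basis scale d W"
    and A: "Vector_Spaces.linear scale scale A" and As: "Vector_Spaces.linear scale scale As"
    and AW: "\<And>i. i \<le> d \<Longrightarrow> A (W i) = (\<delta> + t * of_nat i + (- t) * of_nat (d - i)) *s W i
      + (m' * of_nat i) *s W (i - 1) + (m' * of_nat (d - i)) *s W (i + 1)"
    and AsW: "\<And>i. i \<le> d \<Longrightarrow> As (W i) = (\<delta>s + ms * of_nat i + (- ms) * of_nat (d - i)) *s W i"
    and char: "\<And>k. 1 \<le> k \<Longrightarrow> k \<le> d \<Longrightarrow> (of_nat k :: 'a) \<noteq> 0"
    and m': "m' \<noteq> 0" and \<rho>: "\<rho>\<^sup>2 = t\<^sup>2 + m'\<^sup>2"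
  shows "\<exists>b. ordered_basis scale d b \<and>
    represents scale d b A (lower_bidiag (\<lambda>i. \<delta> + \<rho> * (2 * of_nat i - of_nat d))) \<and>
    represents scale d b As (upper_bidiag (\<lambda>i. \<delta>s + ms * (2 * of_nat i - of_nat d))
      (\<lambda>i. of_nat i * of_nat (d - i + 1) * (2 * ms * (t - \<rho>))))"
proof -
  define u where "u i = form_vector scale d W ([:1, 0:] ^ (d - i) * [:\<rho> - t, m':] ^ i)" for i
  have Au: "A (u i) = (\<delta> + of_nat (d - i) * (- \<rho>) + of_nat i * \<rho>) *s u i
      + (of_nat (d - i) * 1) *s u (i + 1) + (of_nat i * 0) *s u (i - 1)" if "i \<le> d" for i
    unfolding u_def using \<rho>
    by (intro frame_vector_image[OF A AW refl refl _ _ _ _ that])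
      (simp_all add: algebra_simps power2_eq_square)
  have Asu: "As (u i) = (\<delta>s + of_nat (d - i) * (- ms) + of_nat i * ms) *s u i
      + (of_nat (d - i) * 0) *s u (i + 1) + (of_nat i * (2 * ms * (t - \<rho>))) *s u (i - 1)"
    if "i \<le> d" for i
    unfolding u_def
    by (intro frame_vector_image[where b = 0 and c = 0 and a = ms and e = "- ms", OF As _ refl refl _ _ _ _ that])
      (simp_all add: AsW algebra_simps)
  have u: "ordered_basis scale d u"
    unfolding u_def by (rule frame_ordered_basis[OF W dim refl refl]) (simp add: m')
  \<comment> \<open>The subdiagonal entries of \<open>A\<close> with respect to \<open>u\<close> are
    \<open>d - i\<close>; scaling by the falling factorial turns them into \<open>1\<close>.\<close>
  define k :: "nat \<Rightarrow> 'a" where "k i = (\<Prod>j<i. of_nat (d - j))" for i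
  have k: "k i \<noteq> 0" if "i \<le> d" for i
  proof
    assume "k i = 0"
    then obtain j where j: "j < i" "of_nat (d - j) = (0 :: 'a)"
      unfolding k_def prod_zero_iff[OF finite_lessThan] by blast
    then have "1 \<le> d - j" "d - j \<le> d" using that by auto
    then show False using char j(2) by blast
  qed
  have k_Suc: "k (i + 1) = of_nat (d - i) * k i" for i
    unfolding k_def by (simp only: add_0_right Suc_eq_plus1[symmetric] prod.lessThan_Suc mult.commute)
  let ?b = "\<lambda>i. k i *s u i"
  have "A (?b i) = (\<delta> + \<rho> * (2 * of_nat i - of_nat d)) *s ?b i + (if i < d then ?b (i + 1) else 0)"
    if "i \<le> d" for i
    unfolding linear_scale_eq[OF A] Au[OF that] k_Suc
    using that by (auto simp: of_nat_diff scale_right_distrib algebra_simps)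
  moreover have "As (?b i) = (\<delta>s + ms * (2 * of_nat i - of_nat d)) *s ?b i
      + (if 0 < i then (of_nat i * of_nat (d - i + 1) * (2 * ms * (t - \<rho>))) *s ?b (i - 1) else 0)"
    if i: "i \<le> d" for i
  proof -
    have "k i = of_nat (d - i + 1) * k (i - 1)" if "0 < i"
    proof -
      have "i - 1 + 1 = i" "d - (i - 1) = d - i + 1" using that i by auto
      then show ?thesis using k_Suc[of "i - 1"] by simp
    qed
    then have "(k i * (of_nat i * (2 * ms * (t - \<rho>)))) *s u (i - 1) =
        (if 0 < i then (of_nat i * of_nat (d - i + 1) * (2 * ms * (t - \<rho>))) *s ?b (i - 1) else 0)"
      by (cases "0 < i") (simp_all add: mult_ac)
    then show ?thesis
      unfolding linear_scale_eq[OF As] Asu[OF i]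
      using i by (simp add: of_nat_diff scale_right_distrib algebra_simps)
  qed
  ultimately show ?thesis
    using ordered_basis_rescale[OF dim u k]
    by (intro exI[of _ ?b]) (simp add: represents_lower_bidiag represents_upper_bidiag)
qed

text \<open>The frame consists of the eigenvectors of the 2 x 2 matrix of \<open>A\<close> for
  \<open>- m\<close> and \<open>m\<close>; in it the matrix of \<open>As\<close> has both
  off-diagonal entries nonzero.\<close>

lemma krawtchouk_eigenbasis:
  assumes dim: "dim (UNIV :: 'b set) = d + 1" and W: "ordered_basis scale d W"
    and A: "Vector_Spaces.linear scale scale A" and As: "Vector_Spaces.linear scale scale As"
    and AW: "\<And>i. i \<le> d \<Longrightarrow> A (W i) = (\<delta> + t * of_nat i + (- t) * of_nat (d - i)) *s W i
      + (m' * of_nat i) *s W (i - 1) + (m' * of_nat (d - i)) *s W (i + 1)"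
    and AsW: "\<And>i. i \<le> d \<Longrightarrow> As (W i) = (\<delta>s + ms * of_nat i + (- ms) * of_nat (d - i)) *s W i"
    and char: "\<And>k. 1 \<le> k \<Longrightarrow> k \<le> d \<Longrightarrow> (of_nat k :: 'a) \<noteq> 0" and two: "(2 :: 'a) \<noteq> 0"
    and m': "m' \<noteq> 0" and ms: "ms \<noteq> 0" and m: "m \<noteq> 0" "m\<^sup>2 = t\<^sup>2 + m'\<^sup>2"
  shows "\<exists>b M. ordered_basis scale d b \<and>
    represents scale d b A (diag_mat (\<lambda>i. \<delta> + m * (2 * of_nat i - of_nat d))) \<and>
    represents scale d b As M \<and> irred_tridiagonal d M"
proof -
  define u where "u i = form_vector scale d W ([:- m - t, m':] ^ (d - i) * [:m - t, m':] ^ i)" for i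
  \<comment> \<open>On linear forms \<open>As\<close> is \<open>ms\<close> minus twice
    \<open>ms\<close> times the projection to y, and y = (q - p) / (2 m). Substitution gives these
    off-diagonal entries.\<close>
  define \<beta> \<gamma> where "\<beta> = ms * (m + t) / m" and "\<gamma> = ms * (m - t) / m"
  have \<beta>\<gamma>: "m * \<beta> = ms * (m + t)" "m * \<gamma> = ms * (m - t)"
    using m by (simp_all add: \<beta>_def \<gamma>_def)
  \<comment> \<open>The product is the square of \<open>m'\<close>, by the equation for
    \<open>m\<close>.\<close>
  have "(m + t) * (m - t) \<noteq> 0"
    using m m' by (simp add: algebra_simps power2_eq_square)
  then have nz: "\<beta> \<noteq> 0" "\<gamma> \<noteq> 0" using ms m by (auto simp: \<beta>_def \<gamma>_def)
  have Au: "A (u i) = (\<delta> + of_nat (d - i) * (- m) + of_nat i * m) *s u i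
      + (of_nat (d - i) * 0) *s u (i + 1) + (of_nat i * 0) *s u (i - 1)" if "i \<le> d" for i
    unfolding u_def using m
    by (intro frame_vector_image[OF A AW refl refl _ _ _ _ that])
      (simp_all add: algebra_simps power2_eq_square)
  have Asu: "As (u i) = (\<delta>s + of_nat (d - i) * (ms - \<beta>) + of_nat i * (ms - \<gamma>)) *s u i
      + (of_nat (d - i) * \<beta>) *s u (i + 1) + (of_nat i * \<gamma>) *s u (i - 1)"
    if "i \<le> d" for i
    unfolding u_def
  proof (intro frame_vector_image[where b = 0 and c = 0 and a = ms and e = "- ms",
        OF As _ refl refl _ _ _ _ that])
    show "0 * m' + - ms * (- m - t) = (ms - \<beta>) * (- m - t) + \<beta> * (m - t)"
      using \<beta>\<gamma> by algebra
    show "0 * m' + - ms * (m - t) = \<gamma> * (- m - t) + (ms - \<gamma>) * (m - t)"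
      using \<beta>\<gamma> by algebra
  qed (simp_all add: AsW algebra_simps)
  have u: "ordered_basis scale d u"
    unfolding u_def
  proof (rule frame_ordered_basis[OF W dim refl refl])
    have "(- m - t) * m' - m' * (m - t) = - (2 * m * m')" by (simp add: algebra_simps)
    also have "\<dots> \<noteq> 0" using two m m' by simp
    finally show "(- m - t) * m' \<noteq> m' * (m - t)" by simp
  qed
  define M :: "nat \<Rightarrow> nat \<Rightarrow> 'a" where
    "M i j = (if i = j then \<delta>s + of_nat (d - j) * (ms - \<beta>) + of_nat j * (ms - \<gamma>)
      else if i = Suc j then of_nat (d - j) * \<beta> else if j = Suc i then of_nat j * \<gamma> else 0)" for i j
  have "represents scale d u As M"
    by (subst represents_tridiagonal) (auto simp: M_def Asu)
  moreover have "irred_tridiagonal d M"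
  proof -
    have "M (Suc i) i \<noteq> 0 \<and> M i (Suc i) \<noteq> 0" if "i < d" for i
      using that nz char[of "d - i"] char[of "Suc i"] unfolding M_def by auto
    then show ?thesis by (auto simp: irred_tridiagonal_def M_def)
  qed
  moreover have "represents scale d u A (diag_mat (\<lambda>i. \<delta> + m * (2 * of_nat i - of_nat d)))"
    unfolding represents_diag_mat by (auto simp: Au of_nat_diff algebra_simps)
  ultimately show ?thesis using u by blast
qed

section \<open>Near-bipartite expansions\<close>

text \<open>The diagonal entries are quadratic in \<open>i\<close>. Their vanishing at 0, 1, 2 kills
  the second difference, hence \<open>h\<close>, and then the first difference, hence
  \<open>\<tau>\<close>.\<close>

lemma bipartite_krawtchouk_entries:
  assumes b: "ordered_basis scale d b" and w: "ordered_basis scale d w"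
    and A: "Vector_Spaces.linear scale scale A" and As: "Vector_Spaces.linear scale scale As"
    and Ab: "represents scale d b A (lower_bidiag th)"
    and Asb: "represents scale d b As (upper_bidiag ths fsp)"
    and eig: "\<And>i. i \<le> d \<Longrightarrow> As (w i) = ths i *s w i"
    and inj: "inj_on ths {0..d}"
    and T: "represents scale d w A T" and tri: "irred_tridiagonal d T"
    and pd: "primary_data_of_array d th ths fsp ssp \<delta> \<mu> h \<delta>s \<mu>s 0 \<tau>"
    and two: "(2 :: 'a) \<noteq> 0" and \<mu>s: "\<mu>s \<noteq> 0"
    and diag: "\<And>i. i \<le> d \<Longrightarrow> T i i = 0" and d: "2 \<le> d"
  shows "h = 0" and "1 \<le> i \<Longrightarrow> i \<le> d \<Longrightarrow>
    4 * (T (i - 1) i * T i (i - 1)) = of_nat i * (of_nat d - of_nat i + 1) * \<mu>\<^sup>2"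
proof -
  note entries = krawtchouk_tridiagonal_entries[OF b w A As Ab Asb _ inj T tri pd two \<mu>s]
  have four: "(4 :: 'a) \<noteq> 0"
    using two by (metis mult_2 mult_eq_0_iff numeral_Bit0)
  have e: "0 = 2 * \<mu>s * \<delta> + 2 * \<tau> * (2 * of_nat i - of_nat d)
      + h * \<mu>s * (4 * of_nat i * (of_nat i - of_nat d) + of_nat d * (of_nat d - 1))"
    if "i \<le> d" for i
    using entries(1)[OF eig that] diag[OF that] by simp
  have e0: "0 = 2 * \<mu>s * \<delta> - 2 * \<tau> * of_nat d + h * \<mu>s * (of_nat d * (of_nat d - 1))"
    using e[of 0] by simp
  have e1: "0 = 2 * \<mu>s * \<delta> + 2 * \<tau> * (2 - of_nat d)
      + h * \<mu>s * (4 * (1 - of_nat d) + of_nat d * (of_nat d - 1))"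
    using e[of 1] d by simp
  have e2: "0 = 2 * \<mu>s * \<delta> + 2 * \<tau> * (4 - of_nat d)
      + h * \<mu>s * (8 * (2 - of_nat d) + of_nat d * (of_nat d - 1))"
    using e[of 2] d by simp
  have "4 * (2 * (h * \<mu>s)) = 0" using e0 e1 e2 by algebra
  then show h: "h = 0" using four two \<mu>s by (metis mult_eq_0_iff)
  have "4 * \<tau> = 0" using e0 e1 unfolding h by algebra
  then have \<tau>: "\<tau> = 0" using four by simp
  show "4 * (T (i - 1) i * T i (i - 1)) = of_nat i * (of_nat d - of_nat i + 1) * \<mu>\<^sup>2"
    if i: "1 \<le> i" "i \<le> d"
  proof -
    have "4 * \<mu>s\<^sup>2 * (T (i - 1) i * T i (i - 1)) =
      of_nat i * (of_nat d - of_nat i + 1) * (\<mu>\<^sup>2 * \<mu>s\<^sup>2)"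
      using entries(2)[OF eig i] by (simp add: h \<tau>)
    then have "\<mu>s\<^sup>2 * (4 * (T (i - 1) i * T i (i - 1))) =
        \<mu>s\<^sup>2 * (of_nat i * (of_nat d - of_nat i + 1) * \<mu>\<^sup>2)"
      by (simp only: mult_ac)
    then show ?thesis using \<mu>s by simp
  qed
qed

text \<open>The given ordering is an arithmetic progression, being equal to one up to reversal. Its
  distinct terms force \<open>k * c\<close> to be nonzero for \<open>1 \<le> k \<le> d\<close>,
  which controls the characteristic; its second difference at 0, 1, 2 is
  \<open>- 2 * hs\<close>.\<close>

lemma krawtchouk_second_ordering:
  assumes As: "Vector_Spaces.linear scale scale As" and B: "Vector_Spaces.linear scale scale B"
    and kr: "krawtchouk_type scale d B As" and so: "standard_ordering scale d As B ths"
    and ths: "\<forall>i\<le>d. ths i = \<delta>s + \<mu>s * (of_nat i - of_nat d / 2) + hs * of_nat i * of_nat (d - i)"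
  shows "hs = 0" and "\<mu>s \<noteq> 0" and "1 \<le> k \<Longrightarrow> k \<le> d \<Longrightarrow> (of_nat k :: 'a) \<noteq> 0"
proof -
  have d: "3 \<le> d" using kr by (simp add: krawtchouk_type_def type_II_def)
  obtain ths0 c0 where "standard_ordering scale d As B ths0" "\<forall>i\<in>{1..d}. ths0 i - ths0 (i - 1) = c0"
    using kr unfolding krawtchouk_type_def by blast
  from standard_ordering_arithmetic_progression[OF B As this(1) so this(2)]
  obtain c where c: "\<And>i. 1 \<le> i \<Longrightarrow> i \<le> d \<Longrightarrow> ths i - ths (i - 1) = c" by auto
  have inj: "inj_on ths {0..d}" using so by (simp add: standard_ordering_def bij_betw_def)
  have ap: "ths i = ths 0 + of_nat i * c" if "i \<le> d" for i
    using that
  proof (induction i)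
    case (Suc i)
    then show ?case using c[of "Suc i"] by (simp add: algebra_simps)
  qed simp
  have nz: "of_nat k * c \<noteq> 0" if "1 \<le> k" "k \<le> d" for k
    using ap[OF that(2)] inj that by (auto simp: inj_on_eq_iff)
  then show char: "(of_nat k :: 'a) \<noteq> 0" if "1 \<le> k" "k \<le> d" for k
    using that by fastforce
  have two: "(2 :: 'a) \<noteq> 0" using char[of 2] d by simp
  have "ths 2 - 2 * ths 1 + ths 0 = 0"
    using ap[of 1] ap[of 2] d by simp
  moreover have "ths 2 - 2 * ths 1 + ths 0 = - 2 * hs"
  proof -
    define n q where "n = (of_nat d :: 'a)" and "q = n / 2"
    have "ths 0 = \<delta>s + \<mu>s * (0 - q)" "ths 1 = \<delta>s + \<mu>s * (1 - q) + hs * (n - 1)"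
      "ths 2 = \<delta>s + \<mu>s * (2 - q) + hs * 2 * (n - 2)"
      using ths d by (auto simp: n_def q_def of_nat_diff)
    then show ?thesis by algebra
  qed
  ultimately show hs: "hs = 0" using two by simp
  have "c = \<mu>s" using c[of 1] ths d by (simp add: hs algebra_simps)
  then show "\<mu>s \<noteq> 0" using nz[of 1] d by auto
qed

lemma near_bipartite_expansion_condition:
  assumes kr: "krawtchouk_type scale d B As"
    and pa: "parameter_array scale d B As th' ths fsp' ssp'"
    and pd: "primary_data_of_array d th' ths fsp' ssp' \<delta>' \<mu>' h' \<delta>s \<mu>s hs \<tau>'"
    and exp: "near_bipartite_expansion scale d A B As"
    and pdA: "primary_data scale d A As \<delta> \<mu> h \<delta>s \<mu>s hs \<tau>"
  shows "\<mu> \<noteq> 0" and "h = 0" and "4 * \<tau>\<^sup>2 = (\<mu>\<^sup>2 - \<mu>'\<^sup>2) * \<mu>s\<^sup>2"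
    and "krawtchouk_type scale d A As"
proof -
  have d: "3 \<le> d" using kr by (simp add: krawtchouk_type_def type_II_def)
  have linB: "Vector_Spaces.linear scale scale B" and linAs: "Vector_Spaces.linear scale scale As"
    using pa by (simp_all add: parameter_array_def leonard_pair_def)
  have so: "standard_ordering scale d As B ths" using pa by (simp add: parameter_array_def)
  have ths: "\<forall>i\<le>d. ths i = \<delta>s + \<mu>s * (of_nat i - of_nat d / 2) + hs * of_nat i * of_nat (d - i)"
    using pd unfolding primary_data_of_array_def by blast
  note second = krawtchouk_second_ordering[OF linAs linB kr so ths]
  note \<mu>s = second(2)
  have hs: "hs = 0" by (rule second(1))
  have char: "(of_nat k :: 'a) \<noteq> 0" if "1 \<le> k" "k \<le> d" for k using second(3) that .
  have two: "(2 :: 'a) \<noteq> 0" using char[of 2] d by simp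
  obtain thA thsA fspA sspA where paA: "parameter_array scale d A As thA thsA fspA sspA"
    and pdaA: "primary_data_of_array d thA thsA fspA sspA \<delta> \<mu> h \<delta>s \<mu>s 0 \<tau>"
    and IIA: "type_II scale d A As"
    using pdA unfolding primary_data_def hs by blast
  have linA: "Vector_Spaces.linear scale scale A"
    using paA by (simp add: parameter_array_def leonard_pair_def)
  have soA: "standard_ordering scale d A As thA" "standard_ordering scale d As A thsA"
    using paA by (simp_all add: parameter_array_def)
  have injA: "inj_on thA {0..d}" "inj_on thsA {0..d}"
    using soA by (simp_all add: standard_ordering_def bij_betw_def)
  have inj: "inj_on ths {0..d}" using so by (simp add: standard_ordering_def bij_betw_def)
  obtain w T where w: "ordered_basis scale d w" "represents scale d w As (diag_mat thsA)"
      "represents scale d w A T" "irred_tridiagonal d T"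
    using soA(2) unfolding standard_ordering_def by blast
  have eigA: "As (w i) = thsA i *s w i" if "i \<le> d" for i
    using w(2) that by (simp add: represents_diag_mat)
  \<comment> \<open>Both primary data contain the same \<open>\<delta>s\<close>,
    \<open>\<mu>s\<close>, \<open>hs\<close>.\<close>
  have "thsA i = ths i" if "i \<le> d" for i
    using that ths pdaA unfolding primary_data_of_array_def hs by auto
  then have eig: "As (w i) = ths i *s w i" if "i \<le> d" for i
    using eigA that by simp
  define T0 where "T0 i j = (if i = j then 0 else T i j)" for i j
  have T0: "represents scale d w B T0"
    unfolding represents_def
  proof (intro allI impI)
    fix j assume j: "j \<le> d"
    have "flat_part scale A As (w j) = (\<Sum>i=0..d. (if i = j then T i i else 0) *s w i)"
    proof -
      have "flat_part scale A As (w j) = (\<Sum>i=0..d. (T i i * coord scale d w (w j) i) *s w i)"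
        by (rule flat_part_eigenbasis[OF w(1) linAs _ injA(2) linA w(3)]) (rule eigA)
      also have "\<dots> = (\<Sum>i=0..d. (if i = j then T i i else 0) *s w i)"
        using j by (intro sum.cong) (auto simp: coord_basis[OF w(1)])
      finally show ?thesis .
    qed
    then have "B (w j) = (\<Sum>i=0..d. T i j *s w i) - (\<Sum>i=0..d. (if i = j then T i i else 0) *s w i)"
      using exp w(3) j by (auto simp: near_bipartite_expansion_def remove_flat_def represents_def)
    also have "\<dots> = (\<Sum>i=0..d. T0 i j *s w i)"
      unfolding sum_subtractf[symmetric] T0_def by (intro sum.cong) auto
    finally show "B (w j) = (\<Sum>i=0..d. T0 i j *s w i)" .
  qed
  have tri0: "irred_tridiagonal d T0"
    using w(4) unfolding irred_tridiagonal_def T0_def by auto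
  obtain b where b: "ordered_basis scale d b" "represents scale d b B (lower_bidiag th')"
      "represents scale d b As (upper_bidiag ths fsp')"
    using pa unfolding parameter_array_def by blast
  obtain bA where bA: "ordered_basis scale d bA" "represents scale d bA A (lower_bidiag thA)"
      "represents scale d bA As (upper_bidiag thsA fspA)"
    using paA unfolding parameter_array_def by blast
  \<comment> \<open>\<open>A\<close> and \<open>B\<close> share the products of opposite
    off-diagonal entries. The common factor \<open>i * (d - i + 1)\<close> is nonzero in the
    field.\<close>
  have product: "\<mu>'\<^sup>2 * \<mu>s\<^sup>2 = \<mu>\<^sup>2 * \<mu>s\<^sup>2 - (2 * \<tau> + h * \<mu>s * (2 * of_nat i - of_nat d - 1))\<^sup>2"
    if i: "1 \<le> i" "i \<le> d" for i
  proof -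
    have "4 * (T0 (i - 1) i * T0 i (i - 1)) = of_nat i * (of_nat d - of_nat i + 1) * \<mu>'\<^sup>2"
      by (rule bipartite_krawtchouk_entries(2)[OF b(1) w(1) linB linAs b(2,3) _ inj T0 tri0
            pd[unfolded hs] two \<mu>s]) (use eig d i in \<open>auto simp: T0_def\<close>)
    moreover have "T0 (i - 1) i * T0 i (i - 1) = T (i - 1) i * T i (i - 1)"
      using i by (simp add: T0_def)
    moreover have "4 * \<mu>s\<^sup>2 * (T (i - 1) i * T i (i - 1)) = of_nat i * (of_nat d - of_nat i + 1) *
        (\<mu>\<^sup>2 * \<mu>s\<^sup>2 - (2 * \<tau> + h * \<mu>s * (2 * of_nat i - of_nat d - 1))\<^sup>2)"
      by (rule krawtchouk_tridiagonal_entries(2)[OF bA(1) w(1) linA linAs bA(2,3) _ injA(2) w(3,4)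
            pdaA two \<mu>s i]) (rule eigA)
    ultimately have "of_nat i * (of_nat d - of_nat i + 1) * (\<mu>'\<^sup>2 * \<mu>s\<^sup>2) =
        of_nat i * (of_nat d - of_nat i + 1) *
        (\<mu>\<^sup>2 * \<mu>s\<^sup>2 - (2 * \<tau> + h * \<mu>s * (2 * of_nat i - of_nat d - 1))\<^sup>2)"
      by algebra
    moreover have "(of_nat d - of_nat i + 1 :: 'a) = of_nat (d - i + 1)"
      using i by (simp add: of_nat_diff)
    moreover have "of_nat (d - i + 1) \<noteq> (0 :: 'a)" using i by (intro char) auto
    ultimately show ?thesis using char[OF i] by (metis mult_cancel_left mult_eq_0_iff)
  qed
  have p1: "\<mu>'\<^sup>2 * \<mu>s\<^sup>2 = \<mu>\<^sup>2 * \<mu>s\<^sup>2 - (2 * \<tau> + h * \<mu>s * (2 - of_nat d - 1))\<^sup>2"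
    using product[of 1] d by simp
  have p2: "\<mu>'\<^sup>2 * \<mu>s\<^sup>2 = \<mu>\<^sup>2 * \<mu>s\<^sup>2 - (2 * \<tau> + h * \<mu>s * (4 - of_nat d - 1))\<^sup>2"
    using product[of 2] d by simp
  have p3: "\<mu>'\<^sup>2 * \<mu>s\<^sup>2 = \<mu>\<^sup>2 * \<mu>s\<^sup>2 - (2 * \<tau> + h * \<mu>s * (6 - of_nat d - 1))\<^sup>2"
    using product[of 3] d by simp
  \<comment> \<open>The same square arises from three terms in arithmetic progression with
    difference \<open>2 * h * \<mu>s\<close>; the second difference of their squares is
    \<open>8 * (h * \<mu>s)^2\<close>.\<close>
  have "2 * (2 * (2 * (h * \<mu>s)\<^sup>2)) = 0" using p1 p2 p3 by algebra
  then show h: "h = 0" using two \<mu>s by (metis mult_eq_0_iff zero_eq_power2)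
  show "4 * \<tau>\<^sup>2 = (\<mu>\<^sup>2 - \<mu>'\<^sup>2) * \<mu>s\<^sup>2" using p1 unfolding h by algebra
  have formula: "thA i = \<delta> + \<mu> * (of_nat i - of_nat d / 2)"
    "thsA i = \<delta>s + \<mu>s * (of_nat i - of_nat d / 2)" if "i \<le> d" for i
    using pdaA that unfolding primary_data_of_array_def h by simp_all
  have thA: "thA i - thA (i - 1) = \<mu>" and thsA: "thsA i - thsA (i - 1) = \<mu>s" if "i \<in> {1..d}" for i
    using that by (auto simp: formula of_nat_diff algebra_simps)
  have "thA 1 \<noteq> thA 0" using injA(1) d by (auto simp: inj_on_eq_iff)
  then show "\<mu> \<noteq> 0" using thA[of 1] d by auto
  show "krawtchouk_type scale d A As"
    unfolding krawtchouk_type_def using IIA soA thA thsA by blast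
qed

lemma near_bipartite_expansion_exists:
  assumes dim: "dim (UNIV :: 'b set) = d + 1" and kr: "krawtchouk_type scale d B As"
    and bip: "bipartite_leonard_pair scale d B As"
    and pa: "parameter_array scale d B As th' ths fsp' ssp'"
    and pd: "primary_data_of_array d th' ths fsp' ssp' \<delta>' \<mu>' h' \<delta>s \<mu>s hs \<tau>'"
    and \<mu>: "\<mu> \<noteq> 0" and \<tau>: "4 * \<tau>\<^sup>2 = (\<mu>\<^sup>2 - \<mu>'\<^sup>2) * \<mu>s\<^sup>2"
  shows "\<exists>A. near_bipartite_expansion scale d A B As \<and>
    primary_data scale d A As \<delta> \<mu> 0 \<delta>s \<mu>s hs \<tau>"
proof -
  have d: "3 \<le> d" using kr by (simp add: krawtchouk_type_def type_II_def)
  have lpB: "leonard_pair scale d B As" using bip by (simp add: bipartite_leonard_pair_def)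
  have linB: "Vector_Spaces.linear scale scale B" and linAs: "Vector_Spaces.linear scale scale As"
    using lpB by (simp_all add: leonard_pair_def)
  have so: "standard_ordering scale d As B ths" "standard_ordering scale d B As th'"
    using pa by (simp_all add: parameter_array_def)
  have ths: "\<forall>i\<le>d. ths i = \<delta>s + \<mu>s * (of_nat i - of_nat d / 2) + hs * of_nat i * of_nat (d - i)"
    using pd unfolding primary_data_of_array_def by blast
  note second = krawtchouk_second_ordering[OF linAs linB kr so(1) ths]
  note \<mu>s = second(2)
  have hs: "hs = 0" by (rule second(1))
  have char: "(of_nat k :: 'a) \<noteq> 0" if "1 \<le> k" "k \<le> d" for k using second(3) that .
  have two: "(2 :: 'a) \<noteq> 0" using char[of 2] d by simp
  have four: "(4 :: 'a) \<noteq> 0"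
    using two by (metis mult_2 mult_eq_0_iff numeral_Bit0)
  have inj: "inj_on ths {0..d}" "inj_on th' {0..d}"
    using so by (simp_all add: standard_ordering_def bij_betw_def)
  obtain w M where w: "ordered_basis scale d w" "represents scale d w As (diag_mat ths)"
      "represents scale d w B M" "irred_tridiagonal d M"
    using so(1) unfolding standard_ordering_def by blast
  have eig: "As (w i) = ths i *s w i" if "i \<le> d" for i
    using w(2) that by (simp add: represents_diag_mat)
  have M_diag: "M i i = 0" if i: "i \<le> d" for i
  proof -
    have "(\<Sum>j=0..d. (M j j * coord scale d w (w i) j) *s w j) = flat_part scale B As (w i)"
      by (rule flat_part_eigenbasis[OF w(1) linAs _ inj(1) linB w(3), symmetric]) (rule eig)
    also have "\<dots> = 0" using bip by (simp add: bipartite_leonard_pair_def)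
    finally have "coord scale d w (\<Sum>j=0..d. (M j j * coord scale d w (w i) j) *s w j) i = 0"
      by (simp add: coord_0[OF w(1)])
    then show ?thesis using i by (simp only: coord_combination[OF w(1) i]) (simp add: coord_basis[OF w(1)])
  qed
  obtain b where b: "ordered_basis scale d b" "represents scale d b B (lower_bidiag th')"
      "represents scale d b As (upper_bidiag ths fsp')"
    using pa unfolding parameter_array_def by blast
  have d2: "2 \<le> d" using d by simp
  note entries = bipartite_krawtchouk_entries[OF b(1) w(1) linB linAs b(2,3) eig inj(1) w(3,4)
            pd[unfolded hs] two \<mu>s M_diag d2, simplified]
  \<comment> \<open>Halves appear because the 2 x 2 matrices have trace zero: eigenvalues
    \<open>m\<close> and \<open>- m\<close> yield \<open>m * (2 * i - d)\<close> on forms of degree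
    \<open>d\<close>. Here \<open>s\<close> is \<open>2 * \<tau> / \<mu>s^2\<close>.\<close>
  define m m' ms t s where "m = \<mu> / 2" and "m' = \<mu>' / 2" and "ms = \<mu>s / 2"
    and "t = \<tau> / \<mu>s" and "s = t / ms"
  have halves: "2 * m = \<mu>" "2 * m' = \<mu>'" "2 * ms = \<mu>s" "t * \<mu>s = \<tau>" "s * ms = t"
    unfolding m_def m'_def ms_def t_def s_def using two \<mu>s by simp_all
  have th'_eq: "th' i = \<delta>' + \<mu>' * (of_nat i - of_nat d / 2)" if "i \<le> d" for i
    using pd that unfolding primary_data_of_array_def entries(1) by simp
  have "th' 1 - th' 0 = \<mu>'"
    using d by (simp add: th'_eq algebra_simps)
  moreover have "th' 1 \<noteq> th' 0" using inj(2) d by (auto simp: inj_on_eq_iff)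
  ultimately have "\<mu>' \<noteq> 0" by auto
  then have nz: "m \<noteq> 0" "m' \<noteq> 0" "ms \<noteq> 0"
    using \<mu> \<mu>s two by (simp_all add: m_def m'_def ms_def)
  \<comment> \<open>The assumed equation for \<open>\<tau>\<close> says that \<open>m\<close> is an
    eigenvalue of the 2 x 2 matrix with rows \<open>(t, m')\<close> and
    \<open>(m', - t)\<close>.\<close>
  have "4 * \<mu>s\<^sup>2 * m\<^sup>2 = 4 * \<mu>s\<^sup>2 * (t\<^sup>2 + m'\<^sup>2)" using \<tau> halves by algebra
  then have m_sq: "m\<^sup>2 = t\<^sup>2 + m'\<^sup>2" using four \<mu>s by simp
  have product: "M (i - 1) i * M i (i - 1) = of_nat i * of_nat (d - i + 1) * m'\<^sup>2"
    if i: "1 \<le> i" "i \<le> d" for i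
  proof -
    have "4 * (M (i - 1) i * M i (i - 1)) = of_nat i * of_nat (d - i + 1) * \<mu>'\<^sup>2"
      using entries(2)[of i] i by (simp add: of_nat_diff algebra_simps)
    also have "\<dots> = 4 * (of_nat i * of_nat (d - i + 1) * m'\<^sup>2)"
      unfolding halves(2)[symmetric] by (simp add: power2_eq_square)
    finally show ?thesis unfolding mult_left_cancel[OF four] .
  qed
  \<comment> \<open>The rescaling that turns the subdiagonal of \<open>B\<close> into
    \<open>m' * (d - i)\<close>. The superdiagonal then becomes \<open>m' * i\<close>, because the
    products of opposite entries are already known.\<close>
  define k where "k i = (\<Prod>j<i. M (j + 1) j / (m' * of_nat (d - j)))" for i
  have k_Suc: "k (i + 1) * (m' * of_nat (d - i)) = k i * M (i + 1) i" if i: "i < d" for i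
  proof -
    have "k (i + 1) = k i * (M (i + 1) i / (m' * of_nat (d - i)))"
      unfolding k_def by (simp only: Suc_eq_plus1[symmetric] prod.lessThan_Suc)
    then show ?thesis using nz(2) char[of "d - i"] i by (simp del: of_nat_diff)
  qed
  have k_nz: "k i \<noteq> 0" if "i \<le> d" for i
    using that
  proof (induction i)
    case 0
    show ?case by (simp add: k_def)
  next
    case (Suc i)
    then show ?case using k_Suc[of i] w(4) by (auto simp: irred_tridiagonal_def)
  qed
  define W where "W i = k i *s w i" for i
  have W: "ordered_basis scale d W"
    unfolding W_def by (rule ordered_basis_rescale[OF dim w(1) k_nz])
  have AsW: "As (W i) = (\<delta>s + ms * of_nat i + (- ms) * of_nat (d - i)) *s W i" if i: "i \<le> d" for i
  proof -
    have "ths i = \<delta>s + ms * of_nat i + (- ms) * of_nat (d - i)"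
      using ths i two by (simp add: hs halves(3)[symmetric] of_nat_diff algebra_simps)
    then show ?thesis by (simp add: W_def linear_scale_eq[OF linAs] eig[OF i])
  qed
  have BW: "B (W i) = (m' * of_nat i) *s W (i - 1) + (m' * of_nat (d - i)) *s W (i + 1)"
    if i: "i \<le> d" for i
  proof -
    have "B (w i) = (\<Sum>j=0..d. M j i *s w j)" using w(3) i by (simp add: represents_def)
    also have "\<dots> = M i i *s w i + (if 0 < i then M (i - 1) i *s w (i - 1) else 0)
        + (if i < d then M (i + 1) i *s w (i + 1) else 0)"
      by (rule sum_tridiagonal[OF i]) (use w(4) i in \<open>auto simp: irred_tridiagonal_def\<close>)
    finally have "B (W i) = (if 0 < i then (k i * M (i - 1) i) *s w (i - 1) else 0)
        + (if i < d then (k i * M (i + 1) i) *s w (i + 1) else 0)"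
      by (simp add: W_def linear_scale_eq[OF linB] M_diag[OF i] scale_right_distrib)
    moreover have "(if i < d then (k i * M (i + 1) i) *s w (i + 1) else 0)
        = (m' * of_nat (d - i)) *s W (i + 1)"
      using i k_Suc[of i] by (auto simp: W_def mult.commute)
    moreover have "(if 0 < i then (k i * M (i - 1) i) *s w (i - 1) else 0) = (m' * of_nat i) *s W (i - 1)"
    proof (cases "0 < i")
      case True
      then have i1: "1 \<le> i" and eqs: "i - 1 + 1 = i" "d - (i - 1) = d - i + 1" using i by auto
      have nz': "m' * of_nat (d - i + 1) \<noteq> 0"
        using nz(2) char[of "d - i + 1"] i1 i by (simp del: of_nat_diff of_nat_add of_nat_Suc)
      have "m' * of_nat (d - i + 1) * (k i * M (i - 1) i) = k (i - 1) * (M (i - 1) i * M i (i - 1))"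
        using k_Suc[of "i - 1"] i1 i unfolding eqs by (simp add: mult_ac)
      also have "\<dots> = m' * of_nat (d - i + 1) * (k (i - 1) * (m' * of_nat i))"
        unfolding product[OF i1 i] by (simp only: power2_eq_square mult_ac)
      finally have "k i * M (i - 1) i = k (i - 1) * (m' * of_nat i)"
        unfolding mult_left_cancel[OF nz'] .
      then show ?thesis using True by (simp add: W_def mult.commute)
    qed simp
    ultimately show ?thesis by simp
  qed
  \<comment> \<open>The prospective flat part: a polynomial of degree at most one in
    \<open>As\<close>, hence diagonal in the basis \<open>W\<close>.\<close>
  define F where "F v = \<delta> *s v + s *s (As v - \<delta>s *s v)" for v
  define A where "A v = B v + F v" for v
  have linF: "Vector_Spaces.linear scale scale F"
    by (rule linearI) (simp_all add: F_def linear_add_eq[OF linAs] linear_scale_eq[OF linAs]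
        scale_right_distrib scale_right_diff_distrib algebra_simps)
  have linA: "Vector_Spaces.linear scale scale A"
    by (rule linearI) (simp_all add: A_def linear_add_eq[OF linB] linear_scale_eq[OF linB]
        linear_add_eq[OF linF] linear_scale_eq[OF linF] scale_right_distrib)
  have FW: "F (W i) = (\<delta> + t * of_nat i + (- t) * of_nat (d - i)) *s W i" if i: "i \<le> d" for i
  proof -
    have "F (W i) = (\<delta> + s * ((\<delta>s + ms * of_nat i + (- ms) * of_nat (d - i)) - \<delta>s)) *s W i"
      unfolding F_def AsW[OF i] scale_left_diff_distrib[symmetric] scale_scale
      by (rule scale_left_distrib[symmetric])
    also have "\<delta> + s * ((\<delta>s + ms * of_nat i + (- ms) * of_nat (d - i)) - \<delta>s)
        = \<delta> + t * of_nat i + (- t) * of_nat (d - i)"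
      unfolding halves(5)[symmetric] by (simp add: algebra_simps)
    finally show ?thesis .
  qed
  have AW: "A (W i) = (\<delta> + t * of_nat i + (- t) * of_nat (d - i)) *s W i
      + (m' * of_nat i) *s W (i - 1) + (m' * of_nat (d - i)) *s W (i + 1)" if "i \<le> d" for i
    unfolding A_def BW[OF that] FW[OF that] by (simp add: algebra_simps)
  define th where "th i = \<delta> + m * (2 * of_nat i - of_nat d)" for i :: nat
  define ths2 where "ths2 i = \<delta>s + ms * (2 * of_nat i - of_nat d)" for i :: nat
  define fsp where "fsp i = of_nat i * of_nat (d - i + 1) * (2 * ms * (t - m))" for i :: nat
  define ssp where "ssp i = of_nat i * of_nat (d - i + 1) * (2 * ms * (t - (- m)))" for i :: nat
  have inj_affine: "inj_on (\<lambda>i. x + y * (2 * of_nat i - of_nat d)) {0..d}" if "y \<noteq> 0" for x y :: 'a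
  proof (rule linorder_inj_onI)
    fix i j :: nat assume ij: "i < j" "j \<in> {0..d}"
    have "(x + y * (2 * of_nat j - of_nat d)) - (x + y * (2 * of_nat i - of_nat d))
        = y * 2 * of_nat (j - i)"
      using ij by (simp add: of_nat_diff algebra_simps)
    also have "\<dots> \<noteq> 0" using that two char[of "j - i"] ij by (simp del: of_nat_diff)
    finally show "x + y * (2 * of_nat i - of_nat d) \<noteq> x + y * (2 * of_nat j - of_nat d)" by auto
  qed auto
  obtain E N where E: "ordered_basis scale d E" "represents scale d E A (diag_mat th)"
      "represents scale d E As N" "irred_tridiagonal d N"
    using krawtchouk_eigenbasis[OF dim W linA linAs AW AsW char two nz(2,3,1) m_sq]
    unfolding th_def by blast
  have split1: "\<exists>b. ordered_basis scale d b \<and> represents scale d b A (lower_bidiag th) \<and>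
      represents scale d b As (upper_bidiag ths2 fsp)"
    using krawtchouk_split_basis[OF dim W linA linAs AW AsW char nz(2) m_sq]
    unfolding th_def ths2_def fsp_def by blast
  \<comment> \<open>Replacing \<open>i\<close> by \<open>d - i\<close> amounts to replacing
    \<open>m\<close> by \<open>- m\<close>, so the second split basis comes from the other square
    root.\<close>
  have rev: "represents scale d b A (lower_bidiag (\<lambda>i. th (d - i))) \<longleftrightarrow>
      represents scale d b A (lower_bidiag (\<lambda>i. \<delta> + - m * (2 * of_nat i - of_nat d)))" for b
    unfolding represents_lower_bidiag th_def
    by (intro all_cong) (simp add: of_nat_diff algebra_simps)
  have split2: "\<exists>b. ordered_basis scale d b \<and> represents scale d b A (lower_bidiag (\<lambda>i. th (d - i))) \<and>
      represents scale d b As (upper_bidiag ths2 ssp)"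
    using krawtchouk_split_basis[OF dim W linA linAs AW AsW char nz(2), of "- m"] m_sq
    unfolding rev ths2_def ssp_def by simp
  define T where "T i j = (if i = j then \<delta> + t * of_nat j + (- t) * of_nat (d - j)
      else if i = Suc j then m' * of_nat (d - j) else if j = Suc i then m' * of_nat j else 0)" for i j
  have T: "represents scale d W A T"
    by (subst represents_tridiagonal) (auto simp: T_def AW)
  have T_irred: "irred_tridiagonal d T"
  proof -
    have "T (Suc i) i \<noteq> 0 \<and> T i (Suc i) \<noteq> 0" if "i < d" for i
      using that nz char[of "d - i"] char[of "Suc i"] unfolding T_def by auto
    then show ?thesis by (auto simp: irred_tridiagonal_def T_def)
  qed
  have W_eig: "As (W i) = ths2 i *s W i" if "i \<le> d" for i
    unfolding AsW[OF that] using that by (simp add: ths2_def of_nat_diff algebra_simps)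
  have inj2: "inj_on ths2 {0..d}" and inj_th: "inj_on th {0..d}"
    unfolding ths2_def th_def using inj_affine nz by blast+
  have AsW_diag: "represents scale d W As (diag_mat ths2)"
    using W_eig by (simp add: represents_diag_mat)
  have E_eig: "A (E i) = th i *s E i" if "i \<le> d" for i
    using E(2) that by (simp add: represents_diag_mat)
  have diag: "diagonal d (diag_mat x)" for x :: "nat \<Rightarrow> 'a"
    by (simp add: diagonal_def diag_mat_def)
  have lpA: "leonard_pair scale d A As"
    unfolding leonard_pair_def using dim linA linAs W T AsW_diag T_irred E diag by blast
  have soA: "standard_ordering scale d A As th"
    unfolding standard_ordering_def bij_betw_def
    using E inj_th eigenvalues_eigenbasis[OF E(1) linA E_eig] by auto
  have soAs: "standard_ordering scale d As A ths2"
    unfolding standard_ordering_def bij_betw_def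
    using W T T_irred AsW_diag inj2 eigenvalues_eigenbasis[OF W linAs W_eig] by auto
  have pdA: "primary_data_of_array d th ths2 fsp ssp \<delta> \<mu> 0 \<delta>s \<mu>s hs \<tau>"
  proof -
    have half: "\<mu> * \<mu>s / 2 = 2 * (m * ms)"
      using two by (simp add: halves(1,3)[symmetric])
    have \<tau>_eq: "\<tau> = 2 * (t * ms)" unfolding halves(4)[symmetric] halves(3)[symmetric] by simp
    have lin: "2 * y * (of_nat i - of_nat d / 2) = y * (2 * of_nat i - of_nat d)"
      for y :: 'a and i :: nat
      using two by (simp add: algebra_simps)
    show ?thesis
      unfolding primary_data_of_array_def half \<tau>_eq hs fsp_def ssp_def th_def ths2_def
        lin[of m, unfolded halves(1)] lin[of ms, unfolded halves(3)]
      by (simp add: algebra_simps)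
  qed
  \<comment> \<open>In an arithmetic progression the quotient compares three steps with one, so it
    is \<open>3\<close>, that is \<open>\<beta> = 2\<close>.\<close>
  have II: "type_II scale d A As"
  proof -
    have "(x + y * (2 * of_nat (i - 2) - of_nat d) - (x + y * (2 * of_nat (i + 1) - of_nat d))) /
        (x + y * (2 * of_nat (i - 1) - of_nat d) - (x + y * (2 * of_nat i - of_nat d))) = 2 + 1"
      if "i \<in> {2..d - 1}" "y \<noteq> 0" for i and x y :: 'a
    proof -
      have "x + y * (2 * of_nat (i - 2) - of_nat d) - (x + y * (2 * of_nat (i + 1) - of_nat d))
          = (2 + 1) * (- (2 * y))"
        using that by (simp add: of_nat_diff algebra_simps)
      moreover have "x + y * (2 * of_nat (i - 1) - of_nat d) - (x + y * (2 * of_nat i - of_nat d))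
          = - (2 * y)"
        using that by (simp add: of_nat_diff algebra_simps)
      ultimately show ?thesis using that two by simp
    qed
    then have "has_beta scale d A As 2"
      unfolding has_beta_def using soA soAs nz unfolding th_def ths2_def by blast
    then show ?thesis using d lpA by (simp add: type_II_def)
  qed
  have "flat_part scale A As v = F v" for v
  proof -
    have "flat_part scale A As v = (\<Sum>i=0..d. (T i i * coord scale d W v i) *s W i)"
      by (rule flat_part_eigenbasis[OF W linAs _ inj2 linA T]) (rule W_eig)
    also have "\<dots> = (\<Sum>i=0..d. coord scale d W v i *s F (W i))"
      by (intro sum.cong) (auto simp: FW T_def mult.commute)
    also have "\<dots> = F v"
      using arg_cong[OF sum_coord[OF W, of v], of F] by (simp only: linear_sum_scale[OF linF])
    finally show ?thesis .
  qed
  then have "remove_flat scale A As = B"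
    by (simp add: fun_eq_iff remove_flat_def A_def)
  then have "near_bipartite_expansion scale d A B As"
    using bip lpA lpB by (simp add: near_bipartite_expansion_def near_bipartite_leonard_pair_def)
  moreover have "primary_data scale d A As \<delta> \<mu> 0 \<delta>s \<mu>s hs \<tau>"
    unfolding primary_data_def parameter_array_def
    using II lpA soA soAs split1 split2 pdA by blast
  ultimately show ?thesis by blast
qed

end

theorem theorem27p1:
  fixes scale :: "'f::alg_closed_field \<Rightarrow> 'v::ab_group_add \<Rightarrow> 'v"
    and d :: nat
    and B As :: "'v \<Rightarrow> 'v"
    and th' ths fsp' ssp' :: "nat \<Rightarrow> 'f"
    and \<delta>' \<mu>' h' \<delta>s \<mu>s hs \<tau>' :: 'f
    and \<delta> \<mu> h \<tau> :: 'f
  assumes "vector_space scale"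
    and "CHAR('f) \<noteq> 2"
    and "d \<ge> 3"
    and "vector_space.dim scale (UNIV :: 'v set) = d + 1"
    and "bipartite_leonard_pair scale d B As"
    and "krawtchouk_type scale d B As"
    and "parameter_array scale d B As th' ths fsp' ssp'"
    and "primary_data_of_array d th' ths fsp' ssp' \<delta>' \<mu>' h' \<delta>s \<mu>s hs \<tau>'"
  shows "((\<exists>A. near_bipartite_expansion scale d A B As \<and>
              primary_data scale d A As \<delta> \<mu> h \<delta>s \<mu>s hs \<tau>)
          \<longleftrightarrow> (\<mu> \<noteq> 0 \<and> h = 0 \<and> 4 * \<tau>\<^sup>2 = (\<mu>\<^sup>2 - \<mu>'\<^sup>2) * \<mu>s\<^sup>2)) \<and>
         (\<forall>A. near_bipartite_expansion scale d A B As \<and>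
              primary_data scale d A As \<delta> \<mu> h \<delta>s \<mu>s hs \<tau>
              \<longrightarrow> krawtchouk_type scale d A As)"
proof -
  interpret vector_space scale by fact
  note nec = near_bipartite_expansion_condition[OF assms(6-8)]
  note suf = near_bipartite_expansion_exists[OF assms(4,6,5,7,8)]
  show ?thesis
  proof (intro conjI allI impI iffI)
    assume "\<mu> \<noteq> 0 \<and> h = 0 \<and> 4 * \<tau>\<^sup>2 = (\<mu>\<^sup>2 - \<mu>'\<^sup>2) * \<mu>s\<^sup>2"
    then show "\<exists>A. near_bipartite_expansion scale d A B As \<and> primary_data scale d A As \<delta> \<mu> h \<delta>s \<mu>s hs \<tau>"
      using suf by simp
  qed (use nec in blast)+
qed

end
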